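(* For each $n$ let $2\le k=k_n\le n$, $\rho=\rho_n\in(0,1)$, and let $\mathcal C=\mathcal C_n$ be a class of subsets of $\{1,\dots,n\}$ of size $k$, with cardinality $N=N_n$. Assume that, as $n\to\infty$, $N\to\infty$, $\log(N)/k\to0$, and $\rho k/\log N\to\infty$. Let $$t=-\rho k+\rho\sqrt{5k\log N}+2\log N .$$ Then the generalized likelihood ratio test $f$ defined by $$f(X)=0\iff\max_{S\in\mathcal C}X^T(\mathbf I-\mathbf A_S^{-1})X\le t$$ has worst-case risk $R^{\max}(f)$ tending to zero as $n\to\infty$.
   Context: For $S\subset\{1,\dots,n\}$ with $|S|=k$, $\mathbf A_S$ is the $n\times n$ matrix with $(\mathbf A_S)_{i,i}=1$, $(\mathbf A_S)_{i,j}=\rho$ for $i\ne j$ with $i,j\in S$, and $(\mathbf A_S)_{i,j}=0$ otherwise. $\mathbb P_0$ is the law of $X\sim\mathcal N(0,\mathbf I)$ on $\mathbb R^n$ and $\mathbb P_S$ the law of $X\sim\mathcal N(0,\mathbf A_S)$. The worst-case risk of a test $f:\mathbb R^n\to\{0,1\}$ is $R^{\max}(f)=\mathbb P_0\{f(X)=1\}+\max_{S\in\mathcal C}\mathbb P_S\{f(X)=0\}$. *)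

theory Defs
  imports
    "HOL-Probability.Probability"
    "Jordan_Normal_Form.Determinant"
    "Jordan_Normal_Form.Gauss_Jordan_Elimination"
begin

(* Vectors in R^n are functions on the index set {..<n}, as in the product measure
   PiM {..<n} (\<lambda>_. lborel).  Coordinates are numbered from 0, to agree with the
   matrix library; so {..<n} plays the role of {1,...,n}. *)

definition quad_form :: "nat \<Rightarrow> real mat \<Rightarrow> (nat \<Rightarrow> real) \<Rightarrow> real" where
  "quad_form n A x = scalar_prod (Matrix.vec n x) (A *\<^sub>v Matrix.vec n x)"

(* Only meaningful for invertible A: otherwise "mat_inverse A" is None. *)
definition mat_inv :: "real mat \<Rightarrow> real mat" where
  "mat_inv A = the (mat_inverse A)"

(* The centred normal law N(0, A) on R^n, given by its density; meant for symmetric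
   positive definite covariance matrices A of size n. *)
definition mvnormal :: "nat \<Rightarrow> real mat \<Rightarrow> (nat \<Rightarrow> real) measure" where
  "mvnormal n A = density (PiM {..<n} (\<lambda>_. lborel))
     (\<lambda>x. ennreal (exp (- quad_form n (mat_inv A) x / 2) / sqrt ((2 * pi) ^ n * Determinant.det A)))"

definition cov_mat :: "nat \<Rightarrow> real \<Rightarrow> nat set \<Rightarrow> real mat" where
  "cov_mat n \<rho> S =
     Matrix.mat n n (\<lambda>(i, j). if i = j then 1 else if i \<in> S \<and> j \<in> S then \<rho> else 0)"

definition law_null :: "nat \<Rightarrow> (nat \<Rightarrow> real) measure" where
  "law_null n = mvnormal n (1\<^sub>m n)"

definition law_alt :: "nat \<Rightarrow> real \<Rightarrow> nat set \<Rightarrow> (nat \<Rightarrow> real) measure" where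
  "law_alt n \<rho> S = mvnormal n (cov_mat n \<rho> S)"

(* A test is a function with values in {0, 1}; \<C> is a finite nonempty class. *)
definition max_risk ::
    "nat \<Rightarrow> real \<Rightarrow> nat set set \<Rightarrow> ((nat \<Rightarrow> real) \<Rightarrow> nat) \<Rightarrow> real" where
  "max_risk n \<rho> \<C> f =
     measure (law_null n) {x \<in> space (law_null n). f x = 1}
     + Max ((\<lambda>S. measure (law_alt n \<rho> S) {x \<in> space (law_alt n \<rho> S). f x = 0}) ` \<C>)"

definition glr_test ::
    "nat \<Rightarrow> real \<Rightarrow> nat set set \<Rightarrow> real \<Rightarrow> (nat \<Rightarrow> real) \<Rightarrow> nat" where
  "glr_test n \<rho> \<C> t x =
     (if Max ((\<lambda>S. quad_form n (1\<^sub>m n - mat_inv (cov_mat n \<rho> S)) x) ` \<C>) \<le> t then 0 else 1)"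

end

theory Submission
  imports Defs "HOL-Real_Asymp.Real_Asymp"
begin

text \<open>
  Write \<open>L = log N\<close>, \<open>s\<close> and \<open>W\<close> for the sum and the sum of squares of the coordinates in \<open>S\<close>, and
  \<open>U = s\<^sup>2 / k\<close>. By the Sherman--Morrison formula the statistic is
  \<open>\<rho>(k-1)/(1-\<rho>+\<rho>k) U - \<rho>/(1-\<rho>) (W - U)\<close>, hence at most \<open>U - \<rho>(W - U)\<close>. Under the null hypothesis
  \<open>U\<close> is the square of a standard normal variable and \<open>W\<close> is chi-square with \<open>k\<close> degrees of freedom;
  exceeding \<open>t\<close> forces \<open>U \<ge> 2L\<close> or \<open>W \<le> k - \<surd>(4.8 k L)\<close>, since \<open>L / k \<rightarrow> 0\<close> makes \<open>2L\<close> smaller than the gap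
  between \<open>\<surd>(5kL)\<close> and \<open>\<surd>(4.8kL)\<close> (any constant strictly between 4 and 5 would do). Both events have probability \<open>o(1/N)\<close>; for the first one this uses
  the factor \<open>1/\<surd>L\<close> in the Gaussian tail.

  Under the alternative the coordinates in \<open>S\<close> are \<open>\<surd>\<rho> w + \<surd>(1-\<rho>) z\<^sub>i\<close> with independent standard normal
  \<open>w\<close> and \<open>z\<^sub>i\<close>, and \<open>W - U \<le> (1-\<rho>) \<Sum>z\<^sub>i\<^sup>2\<close>. Acceptance therefore forces \<open>\<Sum>z\<^sub>i\<^sup>2\<close> to be large or \<open>s\<close> to be
  small. The latter is unlikely even conditionally on \<open>z\<close>, because \<open>s\<close> is \<open>k \<surd>\<rho> w\<close> plus a function of \<open>z\<close>.
\<close>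

section \<open>Rank-one perturbations of diagonal matrices\<close>

text \<open>Keeping \<open>u\<close> and \<open>v\<close> separate lets a scalar factor be absorbed
  into one of them, so that the covariance matrix, its inverse and the identity all have this
  shape.\<close>

definition diag_plus_outer :: "nat \<Rightarrow> (nat \<Rightarrow> real) \<Rightarrow> (nat \<Rightarrow> real) \<Rightarrow> (nat \<Rightarrow> real) \<Rightarrow> real mat" where
  "diag_plus_outer n d u v = Matrix.mat n n (\<lambda>(i, j). (if i = j then d i else 0) + u i * v j)"

lemma det_mat_diag:
  "Determinant.det (Matrix.mat n n (\<lambda>(i, j). if i = j then d i else 0)) = (\<Prod>i<n. d i :: real)"
proof -
  have "Determinant.det (Matrix.mat n n (\<lambda>(i, j). if i = j then d i else 0))
      = prod_list (diag_mat (Matrix.mat n n (\<lambda>(i, j). if i = j then d i else 0)))"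
    by (rule det_upper_triangular[where n = n]) auto
  also have "diag_mat (Matrix.mat n n (\<lambda>(i, j). if i = j then d i else 0)) = map d [0..<n]"
    by (auto simp: diag_mat_def)
  also have "prod_list (map d [0..<n]) = (\<Prod>i<n. d i)"
    by (simp add: prod.distinct_set_conv_list[symmetric] atLeast0LessThan)
  finally show ?thesis .
qed

text \<open>Matrix determinant lemma: in a suitable bordered matrix the Schur complement of the
  corner entry 1 is \<open>?A\<close>, and that of the diagonal block \<open>D\<close> is the scalar
  \<open>c\<close>.\<close>

lemma det_diag_plus_outer:
  assumes d: "\<And>i. i < n \<Longrightarrow> d i \<noteq> 0"
  shows "Determinant.det (diag_plus_outer n d u v) = (\<Prod>i<n. d i) * (1 + (\<Sum>i<n. u i * v i / d i))"
proof -
  let ?s = "1 + (\<Sum>i<n. u i * v i / d i)"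
  txt \<open>Factorise the bordered matrix with blocks \<open>1\<close>, \<open>- v\<^sup>T\<close>, \<open>u\<close>, \<open>D\<close> in two ways into block triangular matrices.\<close>
  define v' where "v' = Matrix.mat 1 n (\<lambda>(_, j). - v j)"
  define u' where "u' = Matrix.mat n 1 (\<lambda>(i, _). u i)"
  define w where "w = Matrix.mat n 1 (\<lambda>(i, _). u i / d i)"
  define D where "D = Matrix.mat n n (\<lambda>(i, j). if i = j then d i else 0)"
  define c where "c = Matrix.mat 1 1 (\<lambda>_. ?s)"
  let ?A = "diag_plus_outer n d u v"
  have car: "v' \<in> carrier_mat 1 n" "u' \<in> carrier_mat n 1" "w \<in> carrier_mat n 1" "D \<in> carrier_mat n n"
    "c \<in> carrier_mat 1 1" "?A \<in> carrier_mat n n"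
    unfolding v'_def u'_def w_def D_def c_def diag_plus_outer_def by auto
  have 1: "u' * v' + ?A = D"
    by (rule eq_matI) (auto simp: u'_def v'_def D_def diag_plus_outer_def scalar_prod_def)
  have 2: "c + v' * w = 1\<^sub>m 1"
    by (rule eq_matI) (auto simp: c_def v'_def w_def scalar_prod_def atLeast0LessThan sum_negf mult.commute)
  have 3: "D * w = u'"
  proof (rule eq_matI)
    fix i j assume "i < dim_row u'" "j < dim_col u'"
    then have ij: "i < n" "j = 0" by (auto simp: u'_def)
    have "(D * w) $$ (i, j) = (\<Sum>l = 0..<n. (if i = l then d i else 0) * (u l / d l))"
      using ij by (simp add: D_def w_def scalar_prod_def)
    also have "\<dots> = (\<Sum>l = 0..<n. if i = l then u i else 0)"
      using d ij by (intro sum.cong) auto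
    finally show "(D * w) $$ (i, j) = u' $$ (i, j)"
      using ij by (simp add: u'_def)
  qed (auto simp: D_def w_def u'_def)
  have M: "four_block_mat (1\<^sub>m 1) (0\<^sub>m 1 n) u' (1\<^sub>m n) * four_block_mat (1\<^sub>m 1) v' (0\<^sub>m n 1) ?A
      = four_block_mat c v' (0\<^sub>m n 1) D * four_block_mat (1\<^sub>m 1) (0\<^sub>m 1 n) w (1\<^sub>m n)"
    using car 1 2 3
    by (subst (1 2) mult_four_block_mat[where ?nr1.0 = 1 and ?n1.0 = 1 and ?n2.0 = n and ?nr2.0 = n and ?nc1.0 = 1 and ?nc2.0 = n])
      (auto simp: left_add_zero_mat[where nr = 1 and nc = n] left_add_zero_mat[where nr = n and nc = 1]
        left_add_zero_mat[where nr = n and nc = n] right_add_zero_mat[where nr = 1 and nc = n]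
        right_add_zero_mat[where nr = n and nc = 1] right_add_zero_mat[where nr = 1 and nc = 1])
  have dL: "Determinant.det (four_block_mat (1\<^sub>m 1) (0\<^sub>m 1 n) y (1\<^sub>m n)) = (1 :: real)"
    if "y \<in> carrier_mat n 1" for y
    by (subst det_four_block_mat_upper_right_zero[OF _ refl that]) auto
  have dR: "Determinant.det (four_block_mat x v' (0\<^sub>m n 1) B) = Determinant.det x * Determinant.det B"
    if "x \<in> carrier_mat 1 1" "B \<in> carrier_mat n n" for x B
    by (rule det_four_block_mat_lower_left_zero[OF that(1) car(1) refl that(2)])
  have dM: "Determinant.det (P * Q) = Determinant.det P * Determinant.det Q"
    if "P \<in> carrier_mat (1 + n) (1 + n)" "Q \<in> carrier_mat (1 + n) (1 + n)" for P Q :: "real mat"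
    using that by (rule det_mult)
  have "Determinant.det ?A = Determinant.det c * Determinant.det D"
    using arg_cong[OF M, of Determinant.det] car
    by (subst (asm) (1 2) dM) (auto simp: dL dR simp del: One_nat_def)
  moreover have "Determinant.det c = ?s"
    by (simp add: c_def det_single)
  ultimately show ?thesis
    by (simp add: D_def det_mat_diag mult.commute)
qed

text \<open>A right inverse of a square matrix over a field is also a left inverse, so
  \<open>mat_inverse\<close> cannot return \<open>None\<close>; uniqueness of inverses then
  identifies its value.\<close>

lemma mat_inv_eqI:
  assumes A: "A \<in> carrier_mat n n" and B: "B \<in> carrier_mat n n" and AB: "A * B = 1\<^sub>m n"
  shows "mat_inv A = B"
proof -
  have BA: "B * A = 1\<^sub>m n"
    by (rule mat_mult_left_right_inverse[OF A B AB])
  have "mat_inverse A \<noteq> None"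
    using mat_inverse(1)[OF A, of undefined] A B AB BA by (auto simp: Units_def ring_mat_def)
  then obtain C where C: "mat_inverse A = Some C" by auto
  note C' = mat_inverse(2)[OF A C]
  have "C = C * (A * B)" using C' AB by auto
  also have "\<dots> = B" using C' A B by (metis assoc_mult_mat left_mult_one_mat)
  finally show ?thesis using C by (simp add: mat_inv_def)
qed

text \<open>Sherman--Morrison formula, with the factor \<open>1 / s\<close> of the correction term
  put into the second vector.\<close>

lemma mat_inv_diag_plus_outer:
  fixes n :: nat and d u v :: "nat \<Rightarrow> real"
  defines "s \<equiv> 1 + (\<Sum>i<n. u i * v i / d i)"
  assumes d: "\<And>i. i < n \<Longrightarrow> d i \<noteq> 0" and s: "s \<noteq> 0"
  shows "mat_inv (diag_plus_outer n d u v)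
    = diag_plus_outer n (\<lambda>i. 1 / d i) (\<lambda>i. - u i / d i) (\<lambda>j. v j / (d j * s))"
proof (rule mat_inv_eqI[where n = n])
  let ?A = "diag_plus_outer n d u v" 
  let ?B = "diag_plus_outer n (\<lambda>i. 1 / d i) (\<lambda>i. - u i / d i) (\<lambda>j. v j / (d j * s))"
  show "?A * ?B = 1\<^sub>m n"
  proof (rule eq_matI)
    fix i j assume "i < dim_row (1\<^sub>m n)" "j < dim_col (1\<^sub>m n)"
    then have i: "i < n" and j: "j < n" by auto
    have "(?A * ?B) $$ (i, j) = (\<Sum>l<n. ((if i = l then d i else 0) + u i * v l) *
        ((if l = j then 1 / d l else 0) + (- u l / d l) * (v j / (d j * s))))"
      using i j by (simp add: diag_plus_outer_def scalar_prod_def atLeast0LessThan)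
    \<comment> \<open>Of the four products, the two containing the diagonal of \<open>?A\<close>
      survive only at \<open>l = i\<close>, and the outer part against the diagonal of
      \<open>?B\<close> only at \<open>l = j\<close>. The two outer parts together sum to a multiple
      of \<open>s - 1\<close>.\<close>
    also have "\<dots> = (\<Sum>l<n. (if l = i then (if i = j then 1 else 0) - u i * (v j / (d j * s)) else 0)
        + (if l = j then u i * v j / d j else 0) - u i * v j / (d j * s) * (u l * v l / d l))"
      using d i j s by (intro sum.cong refl) (auto simp: field_simps)
    also have "\<dots> = (if i = j then 1 else 0) - u i * (v j / (d j * s)) + u i * v j / d j
        - u i * v j / (d j * s) * (s - 1)"
      using i j by (simp only: sum.distrib sum_subtractf sum_distrib_left[symmetric]) (simp add: s_def)
    also have "\<dots> = (if i = j then 1 else 0)"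
      using d[OF j] s by (simp add: field_simps)
    finally show "(?A * ?B) $$ (i, j) = 1\<^sub>m n $$ (i, j)"
      using i j by simp
  qed (auto simp: diag_plus_outer_def)
qed (auto simp: diag_plus_outer_def)

section \<open>Quadratic forms of perturbed diagonal matrices\<close>

lemma quad_form_sum:
  assumes "A \<in> carrier_mat n n"
  shows "quad_form n A x = (\<Sum>i<n. \<Sum>j<n. x i * (A $$ (i, j) * x j))"
  using assms
  by (auto simp: quad_form_def scalar_prod_def atLeast0LessThan sum_distrib_left intro!: sum.cong)

lemma quad_form_diag_plus_outer:
  "quad_form n (diag_plus_outer n d u v) x = (\<Sum>i<n. d i * (x i)\<^sup>2) + (\<Sum>i<n. u i * x i) * (\<Sum>i<n. v i * x i)"
proof -
  have "quad_form n (diag_plus_outer n d u v) x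
      = (\<Sum>i<n. \<Sum>j<n. (if j = i then d i * (x i)\<^sup>2 else 0) + (u i * x i) * (v j * x j))"
    by (subst quad_form_sum)
      (auto simp: diag_plus_outer_def power2_eq_square algebra_simps intro!: sum.cong)
  then show ?thesis
    by (simp add: sum.distrib sum_product)
qed

lemma quad_form_one_minus:
  assumes "A \<in> carrier_mat n n"
  shows "quad_form n (1\<^sub>m n - A) x = (\<Sum>i<n. (x i)\<^sup>2) - quad_form n A x"
proof -
  have "quad_form n (1\<^sub>m n - A) x
      = (\<Sum>i<n. \<Sum>j<n. (if j = i then (x i)\<^sup>2 else 0) - x i * (A $$ (i, j) * x j))"
    using assms by (subst quad_form_sum)
      (auto simp: power2_eq_square algebra_simps intro!: sum.cong)
  then show ?thesis
    using assms by (simp add: sum_subtractf quad_form_sum)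
qed

text \<open>What remains of the unit diagonal once the rank-one part \<open>\<rho>\<close> on
  \<open>S\<close> is split off. It is also the conditional variance of a coordinate given the
  common factor in the representation used for the alternative.\<close>

definition residual_var :: "real \<Rightarrow> nat set \<Rightarrow> nat \<Rightarrow> real" where
  "residual_var \<rho> S i = (if i \<in> S then 1 - \<rho> else 1)"

lemma cov_mat_diag_plus_outer:
  "cov_mat n \<rho> S = diag_plus_outer n (residual_var \<rho> S) (\<lambda>i. \<rho> * indicator S i) (indicator S)"
  unfolding cov_mat_def diag_plus_outer_def residual_var_def
  by (rule eq_matI) (auto simp: indicator_def)

lemma sum_indicator_subset:
  fixes f :: "'a \<Rightarrow> real"
  assumes "finite A" "S \<subseteq> A"
  shows "(\<Sum>i\<in>A. indicator S i * f i) = (\<Sum>i\<in>S. f i)"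
  using assms by (simp add: indicator_def if_distrib[of "\<lambda>a. a * _"] sum.If_cases Int_absorb1 cong: if_cong)

lemma prod_if_subset:
  fixes f g :: "'a \<Rightarrow> real"
  assumes "finite A" "S \<subseteq> A"
  shows "(\<Prod>i\<in>A. if i \<in> S then f i else g i) = (\<Prod>i\<in>S. f i) * (\<Prod>i\<in>A - S. g i)"
  using assms by (simp add: prod.If_cases Int_absorb1 Diff_eq)

section \<open>Determinant, inverse and test statistic of the covariance matrix\<close>

context
  fixes n :: nat and \<rho> :: real and S :: "nat set"
  assumes \<rho>: "0 \<le> \<rho>" "\<rho> < 1" and S: "S \<subseteq> {..<n}"
begin

text \<open>This is the scalar \<open>s\<close> of the determinant and inverse formulas. Times
  \<open>1 - \<rho>\<close> it becomes \<open>1 - \<rho> + \<rho> * card S\<close>, the eigenvalue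
  of the covariance matrix at the indicator vector of a nonempty \<open>S\<close>.\<close>

lemma sum_outer_over_residual_var:
  "1 + (\<Sum>i<n. \<rho> * indicator S i * indicator S i / residual_var \<rho> S i) = 1 + \<rho> * card S / (1 - \<rho>)"
proof -
  have "(\<Sum>i<n. \<rho> * indicator S i * indicator S i / residual_var \<rho> S i) = (\<Sum>i<n. indicator S i * (\<rho> / (1 - \<rho>)))"
    by (intro sum.cong) (auto simp: indicator_def residual_var_def)
  then show ?thesis by (simp only: sum_indicator_subset[OF finite_lessThan S]) simp
qed

lemma residual_var_pos: "0 < residual_var \<rho> S i"
  using \<rho> by (simp add: residual_var_def)

lemma det_cov_mat:
  "Determinant.det (cov_mat n \<rho> S) = (1 - \<rho>) ^ card S * (1 + \<rho> * card S / (1 - \<rho>))"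
proof -
  have "(\<Prod>i<n. residual_var \<rho> S i) = (1 - \<rho>) ^ card S"
    by (simp add: residual_var_def prod_if_subset[OF finite_lessThan S])
  then show ?thesis
    unfolding cov_mat_diag_plus_outer
    using residual_var_pos by (subst det_diag_plus_outer) (auto simp: less_imp_neq[symmetric] sum_outer_over_residual_var)
qed

lemma mat_inv_cov_mat:
  "mat_inv (cov_mat n \<rho> S) = diag_plus_outer n (\<lambda>i. 1 / residual_var \<rho> S i) (\<lambda>i. - (\<rho> * indicator S i) / residual_var \<rho> S i)
    (\<lambda>j. indicator S j / (residual_var \<rho> S j * (1 + \<rho> * card S / (1 - \<rho>))))"
  unfolding cov_mat_diag_plus_outer
proof (subst mat_inv_diag_plus_outer)
  have "0 \<le> \<rho> * card S / (1 - \<rho>)" using \<rho> by simp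
  then show "1 + (\<Sum>i<n. \<rho> * indicator S i * indicator S i / residual_var \<rho> S i) \<noteq> 0"
    unfolding sum_outer_over_residual_var by linarith
qed (use residual_var_pos in \<open>auto simp: less_imp_neq[symmetric] sum_outer_over_residual_var\<close>)

text \<open>Up to the factor \<open>-1/2\<close> this is the exponent of the alternative density.
  Inside \<open>S\<close> it involves only the sum and the sum of squares.\<close>

lemma quad_form_mat_inv_cov_mat:
  "quad_form n (mat_inv (cov_mat n \<rho> S)) x = (\<Sum>i\<in>{..<n} - S. (x i)\<^sup>2)
    + (\<Sum>i\<in>S. (x i)\<^sup>2) / (1 - \<rho>) - \<rho> * (\<Sum>i\<in>S. x i)\<^sup>2 / ((1 - \<rho>) * (1 - \<rho> + \<rho> * card S))"
proof -
  let ?s = "1 + \<rho> * card S / (1 - \<rho>)"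
  have 1: "(\<Sum>i<n. 1 / residual_var \<rho> S i * (x i)\<^sup>2) = (\<Sum>i\<in>{..<n} - S. (x i)\<^sup>2) + (\<Sum>i\<in>S. (x i)\<^sup>2) / (1 - \<rho>)"
  proof -
    have "(\<Sum>i<n. 1 / residual_var \<rho> S i * (x i)\<^sup>2) = (\<Sum>i\<in>{..<n} - S. 1 / residual_var \<rho> S i * (x i)\<^sup>2) + (\<Sum>i\<in>S. 1 / residual_var \<rho> S i * (x i)\<^sup>2)"
      using S by (intro sum.subset_diff) auto
    also have "(\<Sum>i\<in>S. 1 / residual_var \<rho> S i * (x i)\<^sup>2) = (\<Sum>i\<in>S. (x i)\<^sup>2) / (1 - \<rho>)"
      by (simp add: residual_var_def sum_divide_distrib)
    finally show ?thesis by (simp add: residual_var_def)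
  qed
  have 2: "(\<Sum>i<n. - (\<rho> * indicator S i) / residual_var \<rho> S i * x i) = (\<Sum>i\<in>S. x i) * (- \<rho> / (1 - \<rho>))"
    unfolding sum_distrib_right sum_indicator_subset[OF finite_lessThan S, symmetric]
    by (intro sum.cong) (auto simp: indicator_def residual_var_def)
  have 3: "(\<Sum>j<n. indicator S j / (residual_var \<rho> S j * ?s) * x j) = (\<Sum>i\<in>S. x i) * (1 / ((1 - \<rho>) * ?s))"
    unfolding sum_distrib_right sum_indicator_subset[OF finite_lessThan S, symmetric]
    by (intro sum.cong) (auto simp: indicator_def residual_var_def)
  have 4: "(1 - \<rho>) * ?s = 1 - \<rho> + \<rho> * card S"
    using \<rho> by (simp add: field_simps)
  show ?thesis
    unfolding mat_inv_cov_mat quad_form_diag_plus_outer 1 2 3 4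
    using \<rho> by (simp add: power2_eq_square)
qed

text \<open>The coordinates outside \<open>S\<close> cancel against the identity, and
  \<open>1 - 1 / (1 - \<rho>)\<close> is \<open>- \<rho> / (1 - \<rho>)\<close>.\<close>

lemma quad_form_glr:
  "quad_form n (1\<^sub>m n - mat_inv (cov_mat n \<rho> S)) x
    = \<rho> / (1 - \<rho>) * ((\<Sum>i\<in>S. x i)\<^sup>2 / (1 - \<rho> + \<rho> * card S) - (\<Sum>i\<in>S. (x i)\<^sup>2))"
proof -
  have "(\<Sum>i<n. (x i)\<^sup>2) = (\<Sum>i\<in>{..<n} - S. (x i)\<^sup>2) + (\<Sum>i\<in>S. (x i)\<^sup>2)"
    using S by (intro sum.subset_diff) auto
  moreover have "mat_inv (cov_mat n \<rho> S) \<in> carrier_mat n n"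
    by (simp add: mat_inv_cov_mat diag_plus_outer_def)
  moreover have "a - a / (1 - \<rho>) = - (\<rho> / (1 - \<rho>) * a)" for a
    using \<rho> by (simp add: field_simps)
  from this[of "\<Sum>i\<in>S. (x i)\<^sup>2"] have "(\<Sum>i\<in>S. (x i)\<^sup>2) / (1 - \<rho>)
      = (\<Sum>i\<in>S. (x i)\<^sup>2) + \<rho> / (1 - \<rho>) * (\<Sum>i\<in>S. (x i)\<^sup>2)"
    by linarith
  ultimately show ?thesis
    by (simp add: quad_form_one_minus quad_form_mat_inv_cov_mat right_diff_distrib)
qed

end

section \<open>Standard Gaussian vectors\<close>

definition std_normal :: "real measure" where
  "std_normal = density lborel std_normal_density"

lemma sets_std_normal [measurable_cong, simp]: "sets std_normal = sets borel"
  and space_std_normal [simp]: "space std_normal = UNIV"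
  by (simp_all add: std_normal_def)

lemma measurable_std_normal [simp]: "measurable std_normal M = measurable borel M"
  by (rule measurable_cong_sets) auto

lemma prob_space_std_normal: "prob_space std_normal"
  unfolding std_normal_def by (rule prob_space_normal_density) simp

text \<open>Built as a product of probability laws, so that independence and the factorisation of
  integrals come from the product structure; \<open>distr_std_gauss_affine\<close> links it to
  Lebesgue densities.\<close>

definition std_gauss :: "nat set \<Rightarrow> (nat \<Rightarrow> real) measure" where
  "std_gauss I = PiM I (\<lambda>_. std_normal)"

interpretation std_normal: prob_space std_normal
  by (rule prob_space_std_normal)

interpretation std_normal_prod: product_prob_space "\<lambda>_. std_normal" I for I :: "nat set"
  by standard

interpretation std_gauss: prob_space "std_gauss I" for I
  unfolding std_gauss_def by (intro prob_space_PiM prob_space_std_normal)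

lemma sets_std_gauss [measurable_cong]: "sets (std_gauss I) = sets (PiM I (\<lambda>_. borel))"
  unfolding std_gauss_def by (rule sets_PiM_cong) auto

lemma space_std_gauss: "space (std_gauss I) = extensional I"
  by (simp add: std_gauss_def space_PiM PiE_def)

lemma measurable_std_gauss_component [measurable]:
  "i \<in> I \<Longrightarrow> (\<lambda>z. z i) \<in> borel_measurable (std_gauss I)"
  unfolding measurable_cong_sets[OF sets_std_gauss refl] by measurable

section \<open>Affine images and sums of Gaussian coordinates\<close>

lemma distributed_std_normal: "distributed std_normal lborel (\<lambda>x. x) std_normal_density"
  unfolding distributed_def by (simp add: distr_id2) (simp add: std_normal_def)

lemma distr_std_normal_affine:
  assumes "0 < \<sigma>"
  shows "distr std_normal borel (\<lambda>z. \<mu> + \<sigma> * z) = density lborel (normal_density \<mu> \<sigma>)"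
proof -
  from std_normal.normal_density_affine[OF distributed_std_normal, of \<sigma> \<mu>] assms
  have "distributed std_normal lborel (\<lambda>x. \<mu> + \<sigma> * x) (normal_density \<mu> \<sigma>)" by simp
  then show ?thesis
    by (auto simp: distributed_def cong: distr_cong)
qed

text \<open>Both sides give every box the product of its one-dimensional normal probabilities, and a
  product measure is determined by its values on boxes.\<close>

lemma distr_std_gauss_affine:
  assumes I: "finite I" and \<sigma>: "\<And>i. i \<in> I \<Longrightarrow> 0 < \<sigma> i"
  shows "distr (std_gauss I) (PiM I (\<lambda>_. lborel)) (\<lambda>z. \<lambda>i\<in>I. \<mu> i + \<sigma> i * z i)
    = density (PiM I (\<lambda>_. lborel)) (\<lambda>x. \<Prod>i\<in>I. ennreal (normal_density (\<mu> i) (\<sigma> i) (x i)))"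
    (is "?L = ?R")
proof -
  \<comment> \<open>The default deviation 1 outside \<open>I\<close> makes every \<open>N i\<close>
    a probability measure, as the product locale demands for all indices.\<close>
  define N where "N i = density lborel (normal_density (\<mu> i) (if i \<in> I then \<sigma> i else 1))" for i
  interpret N: product_prob_space N I
    by (rule product_prob_spaceI) (use \<sigma> in \<open>auto simp: N_def intro!: prob_space_normal_density\<close>)
  interpret lb: product_sigma_finite "\<lambda>_. lborel :: real measure"
    by standard
  have sets_N: "sets (PiM I N) = sets (PiM I (\<lambda>_. lborel))"
    by (rule sets_PiM_cong) (auto simp: N_def)
  have N: "emeasure (N i) A = (\<integral>\<^sup>+x. ennreal (normal_density (\<mu> i) (\<sigma> i) x) * indicator A x \<partial>lborel)"
    if "i \<in> I" "A \<in> sets borel" for i A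
    using that by (simp add: N_def emeasure_density)
  have "?R = PiM I N"
  proof (rule N.PiM_eqI[OF I])
    fix A assume A: "\<And>i. i \<in> I \<Longrightarrow> A i \<in> sets (N i)"
    then have [measurable]: "\<And>i. i \<in> I \<Longrightarrow> A i \<in> sets borel" by (auto simp: N_def)
    \<comment> \<open>Membership in \<open>PiE I A\<close> includes extensionality, so the indicator
      of a box factorises only for extensional \<open>x\<close>.\<close>
    have ind: "(\<Prod>i\<in>I. ennreal (normal_density (\<mu> i) (\<sigma> i) (x i))) * indicator (PiE I A) x
        = (\<Prod>i\<in>I. ennreal (normal_density (\<mu> i) (\<sigma> i) (x i)) * indicator (A i) (x i))"
      if "x \<in> extensional I" for x
      using that I by (auto simp: prod.distrib indicator_def PiE_iff)
    have "emeasure ?R (PiE I A) = (\<integral>\<^sup>+x. (\<Prod>i\<in>I. ennreal (normal_density (\<mu> i) (\<sigma> i) (x i)))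
        * indicator (PiE I A) x \<partial>PiM I (\<lambda>_. lborel))"
      using I by (intro emeasure_density sets_PiM_I_finite) auto
    also have "\<dots> = (\<integral>\<^sup>+x. (\<Prod>i\<in>I. ennreal (normal_density (\<mu> i) (\<sigma> i) (x i)) * indicator (A i) (x i))
        \<partial>PiM I (\<lambda>_. lborel))"
      by (intro nn_integral_cong ind) (auto simp: space_PiM PiE_def)
    also have "\<dots> = (\<Prod>i\<in>I. emeasure (N i) (A i))"
      using I by (subst lb.product_nn_integral_prod) (auto simp: N intro!: prod.cong)
    finally show "emeasure ?R (PiE I A) = (\<Prod>i\<in>I. emeasure (N i) (A i))" .
  qed (simp add: sets_N)
  moreover have "?L = PiM I N"
  proof (rule N.PiM_eqI[OF I])
    fix A assume A: "\<And>i. i \<in> I \<Longrightarrow> A i \<in> sets (N i)"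
    then have [measurable]: "\<And>i. i \<in> I \<Longrightarrow> A i \<in> sets borel" by (auto simp: N_def)
    have "emeasure ?L (PiE I A)
        = emeasure (std_gauss I) ((\<lambda>z. \<lambda>i\<in>I. \<mu> i + \<sigma> i * z i) -` PiE I A \<inter> space (std_gauss I))"
      using I by (intro emeasure_distr sets_PiM_I_finite) (auto simp: std_gauss_def)
    also have "(\<lambda>z. \<lambda>i\<in>I. \<mu> i + \<sigma> i * z i) -` PiE I A \<inter> space (std_gauss I)
        = PiE I (\<lambda>i. (\<lambda>z. \<mu> i + \<sigma> i * z) -` A i)"
      by (auto simp: std_gauss_def space_PiM PiE_iff)
    also have "emeasure (std_gauss I) \<dots> = (\<Prod>i\<in>I. emeasure std_normal ((\<lambda>z. \<mu> i + \<sigma> i * z) -` A i))"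
      unfolding std_gauss_def using I
      by (intro std_normal_prod.emeasure_PiM) (auto intro!: measurable_sets_borel[of _ borel])
    also have "\<dots> = (\<Prod>i\<in>I. emeasure (N i) (A i))"
    proof (rule prod.cong[OF refl])
      fix i assume i: "i \<in> I"
      then have "N i = distr std_normal borel (\<lambda>z. \<mu> i + \<sigma> i * z)"
        using \<sigma> by (simp add: N_def distr_std_normal_affine)
      then show "emeasure std_normal ((\<lambda>z. \<mu> i + \<sigma> i * z) -` A i) = emeasure (N i) (A i)"
        using i by (simp add: emeasure_distr)
    qed
    finally show "emeasure ?L (PiE I A) = (\<Prod>i\<in>I. emeasure (N i) (A i))" .
  qed (simp add: sets_N)
  ultimately show ?thesis by simp
qed

text \<open>The coordinates are independent standard normal variables, so their sum over
  \<open>S\<close> is centred normal with variance \<open>card S\<close>.\<close>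

lemma distributed_sum_std_gauss:
  assumes "finite I" "S \<subseteq> I" "S \<noteq> {}"
  shows "distributed (std_gauss I) lborel (\<lambda>z. (\<Sum>i\<in>S. z i) / sqrt (card S)) std_normal_density"
proof -
  have coord: "distr (std_gauss I) borel (\<lambda>z. z i) = std_normal" if "i \<in> I" for i
    using distr_PiM_component[of I "\<lambda>_. std_normal" i] that prob_space_std_normal
    by (simp add: std_gauss_def cong: distr_cong)
  \<comment> \<open>Independence is proved by showing that the joint law is the product of the
    marginals; restriction to \<open>I\<close> is the identity on extensional functions.\<close>
  have "distr (std_gauss I) (PiM I (\<lambda>_. borel)) (\<lambda>z. \<lambda>i\<in>I. z i) = distr (std_gauss I) (std_gauss I) (\<lambda>z. z)"
    by (intro distr_cong) (auto simp: sets_std_gauss space_std_gauss extensional_restrict)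
  also have "\<dots> = PiM I (\<lambda>i. distr (std_gauss I) borel (\<lambda>z. z i))"
    by (simp add: distr_id2 coord cong: PiM_cong) (simp add: std_gauss_def)
  finally have "std_gauss.indep_vars I (\<lambda>_. borel) (\<lambda>i z. z i) I"
    using assms by (subst std_gauss.indep_vars_iff_distr_eq_PiM') auto
  then have "std_gauss.indep_vars I (\<lambda>_. borel) (\<lambda>i z. z i) S"
    by (rule std_gauss.indep_vars_subset) fact
  moreover have "distributed (std_gauss I) lborel (\<lambda>z. z i) (normal_density 0 1)" if "i \<in> S" for i
    using coord[of i] that assms by (auto simp: distributed_def std_normal_def cong: distr_cong)
  ultimately have "distributed (std_gauss I) lborel (\<lambda>z. \<Sum>i\<in>S. z i) (normal_density 0 (sqrt (card S)))"
    using std_gauss.sum_indep_normal[of S I "\<lambda>i z. z i" "\<lambda>_. 1" "\<lambda>_. 0"] assms finite_subset[OF assms(2,1)] by simp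
  then show ?thesis
    using std_gauss.normal_standard_normal_convert[of "sqrt (card S)" I "\<lambda>z. \<Sum>i\<in>S. z i" 0] assms finite_subset[OF assms(2,1)]
    by (simp add: card_gt_0_iff)
qed

section \<open>Tail and small-ball bounds for one normal variable\<close>

lemma emeasure_std_normal:
  "A \<in> sets borel \<Longrightarrow> emeasure std_normal A = (\<integral>\<^sup>+x. ennreal (std_normal_density x) * indicator A x \<partial>lborel)"
  by (simp add: std_normal_def emeasure_density)

lemma inverse_sqrt_two_pi_le_one: "1 / sqrt (2 * pi) \<le> 1"
  using pi_gt3 by (simp add: real_le_rsqrt)

text \<open>On the half-line the factor \<open>x / a\<close> is at least 1, and inserting it gives
  an integrand with an explicit primitive. The factor \<open>1 / a\<close> is kept because the union
  bound later leaves nothing else to tend to zero.\<close>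

lemma std_normal_upper_tail:
  assumes a: "0 < a"
  shows "measure std_normal {a..} \<le> exp (- a\<^sup>2 / 2) / a"
proof -
  note pi = inverse_sqrt_two_pi_le_one
  have "emeasure std_normal {a..} = (\<integral>\<^sup>+x. ennreal (std_normal_density x) * indicator {a..} x \<partial>lborel)"
    by (rule emeasure_std_normal) simp
  also have "\<dots> \<le> (\<integral>\<^sup>+x. ennreal (x / a * exp (- x\<^sup>2 / 2)) * indicator {a..} x \<partial>lborel)"
  proof (intro nn_integral_mono)
    fix x :: real
    have "std_normal_density x \<le> x / a * exp (- x\<^sup>2 / 2)" if "a \<le> x"
      unfolding std_normal_density_def using pi a that
      by (intro mult_right_mono order_trans[OF pi]) auto
    then show "ennreal (std_normal_density x) * indicator {a..} x
        \<le> ennreal (x / a * exp (- x\<^sup>2 / 2)) * indicator {a..} x"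
      by (auto simp: indicator_def ennreal_leI)
  qed
  also have "\<dots> = ennreal (0 - (- exp (- a\<^sup>2 / 2) / a))"
  proof (rule nn_integral_FTC_atLeast[where F = "\<lambda>x. - exp (- x\<^sup>2 / 2) / a"])
    show "((\<lambda>x. - exp (- x\<^sup>2 / 2) / a) \<longlongrightarrow> 0) at_top"
      using a by real_asymp
    show "DERIV (\<lambda>x. - exp (- x\<^sup>2 / 2) / a) x :> x / a * exp (- x\<^sup>2 / 2)" for x
      using a by (auto intro!: derivative_eq_intros simp: field_simps)
  qed (use a in auto)
  finally show ?thesis
    using a by (simp add: std_normal.emeasure_eq_measure)
qed

lemma distr_std_normal_uminus: "distr std_normal borel uminus = std_normal"
proof -
  from std_normal.normal_density_affine[OF distributed_std_normal, of "-1" 0]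
  have "distributed std_normal lborel uminus std_normal_density" by simp
  then show ?thesis
    by (auto simp: distributed_def std_normal_def cong: distr_cong)
qed

lemma std_normal_two_sided_tail:
  assumes a: "0 < a"
  shows "measure std_normal {x. a \<le> \<bar>x\<bar>} \<le> 2 * exp (- a\<^sup>2 / 2) / a"
proof -
  have "measure std_normal {..-a} = measure (distr std_normal borel uminus) {..-a}"
    by (simp add: distr_std_normal_uminus)
  also have "\<dots> = measure std_normal {a..}"
    by (subst measure_distr) (auto intro!: arg_cong[where f = "measure std_normal"])
  finally have "measure std_normal {..-a} = measure std_normal {a..}" .
  moreover have "measure std_normal {x. a \<le> \<bar>x\<bar>} \<le> measure std_normal ({..-a} \<union> {a..})"
    by (intro std_normal.finite_measure_mono) auto
  moreover have "measure std_normal ({..-a} \<union> {a..}) \<le> measure std_normal {..-a} + measure std_normal {a..}"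
    by (intro measure_Un_le) auto
  ultimately show ?thesis
    using std_normal_upper_tail[OF a] by simp
qed

text \<open>The density is at most 1 and the event is an interval of length
  \<open>2 * \<delta> / \<alpha>\<close>. Uniformity in \<open>c\<close> allows the bound to be used
  conditionally on other coordinates.\<close>

lemma std_normal_small_ball:
  assumes \<alpha>: "0 < \<alpha>" and \<delta>: "0 \<le> \<delta>"
  shows "measure std_normal {w. \<bar>\<alpha> * w + c\<bar> \<le> \<delta>} \<le> 2 * \<delta> / \<alpha>"
proof -
  note pi = inverse_sqrt_two_pi_le_one
  have 1: "std_normal_density x \<le> 1" for x
    unfolding std_normal_density_def by (intro mult_le_one pi) auto
  have eq: "{w. \<bar>\<alpha> * w + c\<bar> \<le> \<delta>} = {(- c - \<delta>) / \<alpha> .. (\<delta> - c) / \<alpha>}"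
    using \<alpha> by (auto simp: field_simps abs_le_iff)
  have "emeasure std_normal {w. \<bar>\<alpha> * w + c\<bar> \<le> \<delta>}
      = (\<integral>\<^sup>+x. ennreal (std_normal_density x) * indicator {(- c - \<delta>) / \<alpha> .. (\<delta> - c) / \<alpha>} x \<partial>lborel)"
    unfolding eq by (rule emeasure_std_normal) simp
  also have "\<dots> \<le> (\<integral>\<^sup>+x. indicator {(- c - \<delta>) / \<alpha> .. (\<delta> - c) / \<alpha>} x \<partial>lborel)"
    using 1 by (intro nn_integral_mono) (auto simp: indicator_def ennreal_le_1)
  also have "\<dots> = ennreal ((\<delta> - c) / \<alpha> - (- c - \<delta>) / \<alpha>)"
    using \<alpha> \<delta> by (simp add: divide_right_mono)
  also have "(\<delta> - c) / \<alpha> - (- c - \<delta>) / \<alpha> = 2 * \<delta> / \<alpha>"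
    using \<alpha> by (simp add: field_simps)
  finally show ?thesis
    using \<alpha> \<delta> by (simp add: std_normal.emeasure_eq_measure)
qed

section \<open>Laplace transform and tails of the chi-square law\<close>

lemma nn_integral_exp_square_std_normal:
  assumes l: "l < 1 / 2"
  shows "(\<integral>\<^sup>+x. ennreal (exp (l * x\<^sup>2)) \<partial>std_normal) = ennreal (1 / sqrt (1 - 2 * l))"
proof -
  \<comment> \<open>Tilting the standard normal density by \<open>exp (l * x\<^sup>2)\<close> gives
    a multiple of the centred normal density with this deviation.\<close>
  define \<sigma> where "\<sigma> = 1 / sqrt (1 - 2 * l)"
  have \<sigma>: "0 < \<sigma>" and \<sigma>2: "\<sigma>\<^sup>2 = 1 / (1 - 2 * l)"
    using l by (auto simp: \<sigma>_def power_divide)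
  have eq: "std_normal_density x * exp (l * x\<^sup>2) = \<sigma> * normal_density 0 \<sigma> x" for x
  proof -
    have "- x\<^sup>2 / 2 + l * x\<^sup>2 = - x\<^sup>2 / (2 * \<sigma>\<^sup>2)"
      using l unfolding \<sigma>2 by (simp add: field_simps)
    then show ?thesis
      using \<sigma> by (simp add: normal_density_def mult_exp_exp real_sqrt_mult)
  qed
  have "(\<integral>\<^sup>+x. ennreal (exp (l * x\<^sup>2)) \<partial>std_normal)
      = (\<integral>\<^sup>+x. ennreal \<sigma> * ennreal (normal_density 0 \<sigma> x) \<partial>lborel)"
    unfolding std_normal_def using \<sigma>
    by (subst nn_integral_density) (auto simp: ennreal_mult'[symmetric] eq)
  also have "\<dots> = ennreal \<sigma> * (\<integral>\<^sup>+x. ennreal (normal_density 0 \<sigma> x) \<partial>lborel)"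
    by (rule nn_integral_cmult) simp
  also have "(\<integral>\<^sup>+x. ennreal (normal_density 0 \<sigma> x) \<partial>lborel) = 1"
    using \<sigma> by (simp add: nn_integral_eq_integral)
  finally show ?thesis by (simp add: \<sigma>_def)
qed

text \<open>The exponential is a product over the coordinates, with factor 1 outside
  \<open>S\<close>, so the integral factorises.\<close>

lemma nn_integral_exp_chi_square:
  assumes I: "finite I" "S \<subseteq> I" and l: "l < 1 / 2"
  shows "(\<integral>\<^sup>+z. ennreal (exp (l * (\<Sum>i\<in>S. (z i)\<^sup>2))) \<partial>std_gauss I) = ennreal ((1 / sqrt (1 - 2 * l)) ^ card S)"
proof -
  have S: "finite S" using I by (auto intro: finite_subset)
  have "ennreal (exp (l * (\<Sum>i\<in>S. (z i)\<^sup>2)))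
      = (\<Prod>i\<in>I. if i \<in> S then ennreal (exp (l * (z i)\<^sup>2)) else 1)" for z :: "nat \<Rightarrow> real"
    using I S by (simp add: sum_distrib_left exp_sum prod_ennreal prod.If_cases Int_absorb1)
  then have "(\<integral>\<^sup>+z. ennreal (exp (l * (\<Sum>i\<in>S. (z i)\<^sup>2))) \<partial>std_gauss I)
      = (\<integral>\<^sup>+z. (\<Prod>i\<in>I. (if i \<in> S then (\<lambda>x. ennreal (exp (l * x\<^sup>2))) else (\<lambda>_. 1)) (z i)) \<partial>std_gauss I)"
    by (auto intro!: nn_integral_cong prod.cong)
  also have "\<dots> = (\<Prod>i\<in>I. integral\<^sup>N std_normal (if i \<in> S then (\<lambda>x. ennreal (exp (l * x\<^sup>2))) else (\<lambda>_. 1)))"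
    unfolding std_gauss_def using I(1) by (intro std_normal_prod.product_nn_integral_prod) auto
  also have "\<dots> = (\<Prod>i\<in>I. if i \<in> S then ennreal (1 / sqrt (1 - 2 * l)) else 1)"
    by (intro prod.cong refl)
      (auto simp: nn_integral_exp_square_std_normal[OF l] std_normal.emeasure_space_1[unfolded space_std_normal])
  also have "\<dots> = ennreal ((1 / sqrt (1 - 2 * l)) ^ card S)"
    using I S l by (simp add: prod.If_cases Int_absorb1 ennreal_power)
  finally show ?thesis .
qed

text \<open>The difference of the two sides vanishes at 0 and has derivative
  \<open>y\<^sup>2 / (1 + y)\<close>. The second-order term is what yields the constant 4 in the
  lower chi-square tail.\<close>

lemma ln_one_plus_lower_bound:
  fixes x :: real
  assumes "0 \<le> x"
  shows "x - x\<^sup>2 / 2 \<le> ln (1 + x)"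
proof -
  have "(\<lambda>x. ln (1 + x) - (x - x\<^sup>2 / 2)) 0 \<le> (\<lambda>x. ln (1 + x) - (x - x\<^sup>2 / 2)) x"
  proof (rule DERIV_nonneg_imp_nondecreasing[OF assms])
    fix y :: real assume y: "0 \<le> y"
    then have "((\<lambda>x. ln (1 + x) - (x - x\<^sup>2 / 2)) has_real_derivative (1 / (1 + y) - (1 - y))) (at y)"
      by (auto intro!: derivative_eq_intros)
    moreover have "1 / (1 + y) - (1 - y) = y\<^sup>2 / (1 + y)"
      using y by (simp add: field_simps power2_eq_square)
    ultimately show "\<exists>d. ((\<lambda>x. ln (1 + x) - (x - x\<^sup>2 / 2)) has_real_derivative d) (at y) \<and> 0 \<le> d"
      using y by auto
  qed
  then show ?thesis by simp
qed

lemma inverse_sqrt_power: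
  assumes "(0::real) < c"
  shows "(1 / sqrt c) ^ m = exp (- (m / 2 * ln c))"
proof -
  have "1 / sqrt c = exp (- (ln c / 2))"
    using assms by (simp add: exp_minus ln_sqrt[symmetric] inverse_eq_divide)
  then show ?thesis
    by (simp add: exp_of_nat_mult[symmetric])
qed

text \<open>Chernoff bound with a negative exponent. The constant 4 matters: a deviation with
  \<open>y\<^sup>2\<close> slightly below \<open>5 * k * L\<close> must still give a probability
  smaller than \<open>exp (- L)\<close>.\<close>

lemma chi_square_lower_tail:
  fixes y :: real
  assumes I: "finite I" "S \<subseteq> I" and S: "S \<noteq> {}" and y: "0 < y"
  shows "measure (std_gauss I) {z \<in> space (std_gauss I). (\<Sum>i\<in>S. (z i)\<^sup>2) \<le> card S - y} \<le> exp (- y\<^sup>2 / (4 * card S))"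
proof -
  let ?k = "real (card S)"
  \<comment> \<open>Once the logarithm is bounded, the exponent is
    \<open>?k * l\<^sup>2 - l * y\<close>, and this \<open>l\<close> minimises it.\<close>
  define l where "l = y / (2 * ?k)"
  have fS: "finite S" using I by (auto intro: finite_subset)
  then have k: "0 < ?k" using S by (simp add: card_gt_0_iff)
  have l: "0 < l" using y k by (simp add: l_def)
  have [measurable]: "(\<lambda>z. \<Sum>i\<in>S. (z i)\<^sup>2) \<in> borel_measurable (std_gauss I)"
    using I by (intro borel_measurable_sum borel_measurable_power measurable_std_gauss_component) auto
  have "emeasure (std_gauss I) {z \<in> space (std_gauss I). (\<Sum>i\<in>S. (z i)\<^sup>2) \<le> ?k - y}
      \<le> ennreal (exp (l * (?k - y))) * (\<integral>\<^sup>+z. ennreal (exp (- l * (\<Sum>i\<in>S. (z i)\<^sup>2))) * indicator (space (std_gauss I)) z \<partial>std_gauss I)"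
    using l by (intro Chernoff_ineq_nn_integral_le) auto
  also have "(\<integral>\<^sup>+z. ennreal (exp (- l * (\<Sum>i\<in>S. (z i)\<^sup>2))) * indicator (space (std_gauss I)) z \<partial>std_gauss I)
      = (\<integral>\<^sup>+z. ennreal (exp (- l * (\<Sum>i\<in>S. (z i)\<^sup>2))) \<partial>std_gauss I)"
    by (intro nn_integral_cong) auto
  also have "\<dots> = ennreal (exp (- (?k / 2 * ln (1 + 2 * l))))"
    using nn_integral_exp_chi_square[OF I, of "- l"] l inverse_sqrt_power[of "1 + 2 * l" "card S"] by simp
  also have "ennreal (exp (l * (?k - y))) * \<dots> = ennreal (exp (l * (?k - y) - ?k / 2 * ln (1 + 2 * l)))"
    by (simp add: ennreal_mult[symmetric] mult_exp_exp)
  also have "\<dots> \<le> ennreal (exp (- y\<^sup>2 / (4 * ?k)))"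
  proof -
    have "?k / 2 * (2 * l - (2 * l)\<^sup>2 / 2) \<le> ?k / 2 * ln (1 + 2 * l)"
      using ln_one_plus_lower_bound[of "2 * l"] l by (intro mult_left_mono) auto
    moreover have "l * (?k - y) - ?k / 2 * (2 * l - (2 * l)\<^sup>2 / 2) = - y\<^sup>2 / (4 * ?k)"
      using k by (simp add: l_def field_simps power2_eq_square)
    ultimately show ?thesis by (intro ennreal_leI) simp
  qed
  finally show ?thesis
    by (simp add: std_gauss.emeasure_eq_measure)
qed

text \<open>Chernoff bound again. This tail is applied to a single set \<open>S\<close>, without a
  union bound, so a cruder constant is enough.\<close>

lemma chi_square_upper_tail:
  fixes y :: real
  assumes I: "finite I" "S \<subseteq> I" and y: "0 < y" "y \<le> card S"
  shows "measure (std_gauss I) {z \<in> space (std_gauss I). card S + y \<le> (\<Sum>i\<in>S. (z i)\<^sup>2)} \<le> exp (- y\<^sup>2 / (16 * card S))"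
proof -
  let ?k = "real (card S)"
  \<comment> \<open>Minimiser of \<open>4 * ?k * l\<^sup>2 - l * y\<close>; the assumption
    \<open>y \<le> card S\<close> keeps \<open>2 * l\<close> within the range of the logarithm
    bound.\<close>
  define l where "l = y / (8 * ?k)"
  have k: "0 < ?k" using y by linarith
  have l: "0 < l" "l \<le> 1 / 4" using y k by (auto simp: l_def field_simps)
  have [measurable]: "(\<lambda>z. \<Sum>i\<in>S. (z i)\<^sup>2) \<in> borel_measurable (std_gauss I)"
    using I by (intro borel_measurable_sum borel_measurable_power measurable_std_gauss_component) auto
  have "emeasure (std_gauss I) {z \<in> space (std_gauss I). ?k + y \<le> (\<Sum>i\<in>S. (z i)\<^sup>2)}
      \<le> ennreal (exp (- l * (?k + y))) * (\<integral>\<^sup>+z. ennreal (exp (l * (\<Sum>i\<in>S. (z i)\<^sup>2))) * indicator (space (std_gauss I)) z \<partial>std_gauss I)"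
    using l by (intro Chernoff_ineq_nn_integral_ge) auto
  also have "(\<integral>\<^sup>+z. ennreal (exp (l * (\<Sum>i\<in>S. (z i)\<^sup>2))) * indicator (space (std_gauss I)) z \<partial>std_gauss I)
      = (\<integral>\<^sup>+z. ennreal (exp (l * (\<Sum>i\<in>S. (z i)\<^sup>2))) \<partial>std_gauss I)"
    by (intro nn_integral_cong) auto
  also have "\<dots> = ennreal (exp (- (?k / 2 * ln (1 - 2 * l))))"
    using nn_integral_exp_chi_square[OF I, of l] l inverse_sqrt_power[of "1 - 2 * l" "card S"] by simp
  also have "ennreal (exp (- l * (?k + y))) * \<dots> = ennreal (exp (- l * (?k + y) - ?k / 2 * ln (1 - 2 * l)))"
    by (simp add: ennreal_mult[symmetric] mult_exp_exp)
  also have "\<dots> \<le> ennreal (exp (- y\<^sup>2 / (16 * ?k)))"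
  proof -
    have "?k / 2 * (- (2 * l) - 2 * (2 * l)\<^sup>2) \<le> ?k / 2 * ln (1 - 2 * l)"
      using ln_one_minus_pos_lower_bound[of "2 * l"] l by (intro mult_left_mono) auto
    moreover have "- l * (?k + y) - ?k / 2 * (- (2 * l) - 2 * (2 * l)\<^sup>2) = - y\<^sup>2 / (16 * ?k)"
      using k by (simp add: l_def field_simps power2_eq_square)
    ultimately show ?thesis by (intro ennreal_leI) simp
  qed
  finally show ?thesis
    by (simp add: std_gauss.emeasure_eq_measure)
qed

text \<open>The normalised sum is standard normal, so this is its two-sided tail at
  \<open>sqrt (2 * L)\<close>.\<close>

lemma std_gauss_sum_tail:
  assumes I: "finite I" "S \<subseteq> I" and S: "S \<noteq> {}" and L: "0 < L"
  shows "measure (std_gauss I) {z \<in> space (std_gauss I). 2 * L \<le> (\<Sum>i\<in>S. z i)\<^sup>2 / card S}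
    \<le> 2 * exp (- L) / sqrt (2 * L)"
proof -
  let ?f = "\<lambda>z. (\<Sum>i\<in>S. z i) / sqrt (card S)"
  have dist: "distr (std_gauss I) borel ?f = std_normal" "?f \<in> borel_measurable (std_gauss I)"
    using distributed_sum_std_gauss[OF I S] by (auto simp: distributed_def std_normal_def cong: distr_cong)
  have "2 * L \<le> (\<Sum>i\<in>S. z i)\<^sup>2 / card S \<longleftrightarrow> sqrt (2 * L) \<le> \<bar>?f z\<bar>" for z :: "nat \<Rightarrow> real"
    using real_sqrt_le_iff[of "2 * L" "(\<Sum>i\<in>S. z i)\<^sup>2 / card S"]
    by (simp add: real_sqrt_divide abs_divide del: real_sqrt_le_iff)
  then have "{z \<in> space (std_gauss I). 2 * L \<le> (\<Sum>i\<in>S. z i)\<^sup>2 / card S}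
      = ?f -` {x. sqrt (2 * L) \<le> \<bar>x\<bar>} \<inter> space (std_gauss I)" by auto
  then have "measure (std_gauss I) {z \<in> space (std_gauss I). 2 * L \<le> (\<Sum>i\<in>S. z i)\<^sup>2 / card S}
      = measure std_normal {x. sqrt (2 * L) \<le> \<bar>x\<bar>}"
    using dist by (subst dist(1)[symmetric]) (subst measure_distr; simp)
  then show ?thesis
    using std_normal_two_sided_tail[of "sqrt (2 * L)"] L by simp
qed

section \<open>The laws under the two hypotheses\<close>

lemma prod_normal_density:
  "(\<Prod>i\<in>J. normal_density m \<sigma> (x i))
    = (1 / sqrt (2 * pi * \<sigma>\<^sup>2)) ^ card J * exp (- (\<Sum>i\<in>J. (x i - m)\<^sup>2) / (2 * \<sigma>\<^sup>2))"
proof (cases "finite J")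
  case True
  then show ?thesis
    unfolding normal_density_def prod.distrib exp_sum[OF True, symmetric]
    by (simp add: sum_divide_distrib sum_negf)
qed simp

lemma law_null_eq: "law_null n = std_gauss {..<n}"
proof -
  have one: "1\<^sub>m n = diag_plus_outer n (\<lambda>_. 1) (\<lambda>_. 0) (\<lambda>_. 0)"
    by (rule eq_matI) (auto simp: diag_plus_outer_def)
  have inv: "mat_inv (1\<^sub>m n) = 1\<^sub>m n"
    by (rule mat_inv_eqI[where n = n]) auto
  have "exp (- quad_form n (mat_inv (1\<^sub>m n)) x / 2) / sqrt ((2 * pi) ^ n * Determinant.det (1\<^sub>m n))
      = (\<Prod>i<n. std_normal_density (x i))" for x
    unfolding inv det_one unfolding one quad_form_diag_plus_outer prod_normal_density
    by (simp add: real_sqrt_power real_sqrt_mult power_divide power_mult_distrib)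
  then have "law_null n = density (PiM {..<n} (\<lambda>_. lborel)) (\<lambda>x. \<Prod>i<n. ennreal (std_normal_density (x i)))"
    by (simp add: law_null_def mvnormal_def prod_ennreal)
  also have "\<dots> = distr (std_gauss {..<n}) (PiM {..<n} (\<lambda>_. lborel)) (\<lambda>z. \<lambda>i\<in>{..<n}. z i)"
    using distr_std_gauss_affine[of "{..<n}" "\<lambda>_. 1" "\<lambda>_. 0"] by simp
  also have "\<dots> = distr (std_gauss {..<n}) (std_gauss {..<n}) (\<lambda>z. z)"
  proof (intro distr_cong)
    have "sets (Pi\<^sub>M {..<n} (\<lambda>_. lborel :: real measure)) = sets (PiM {..<n} (\<lambda>_. borel))"
      by (rule sets_PiM_cong) auto
    then show "sets (Pi\<^sub>M {..<n} (\<lambda>_. lborel)) = sets (std_gauss {..<n})"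
      by (simp add: sets_std_gauss)
  qed (auto simp: space_std_gauss extensional_restrict)
  finally show ?thesis by (simp add: distr_id2)
qed

text \<open>One-factor representation: \<open>w\<close> is shared by all coordinates in
  \<open>S\<close>, which gives them variance 1 and pairwise covariance \<open>\<rho>\<close>. The
  restriction to \<open>I\<close> makes the result extensional.\<close>

definition equicorrelated :: "nat set \<Rightarrow> real \<Rightarrow> nat set \<Rightarrow> real \<times> (nat \<Rightarrow> real) \<Rightarrow> nat \<Rightarrow> real" where
  "equicorrelated I \<rho> S = (\<lambda>(w, z). \<lambda>i\<in>I. if i \<in> S then sqrt \<rho> * w + sqrt (1 - \<rho>) * z i else z i)"

section \<open>The alternative as a Gaussian mixture over a common factor\<close>

context
  fixes n :: nat and \<rho> :: real and S :: "nat set"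
  assumes \<rho>: "0 \<le> \<rho>" "\<rho> < 1" and S: "S \<subseteq> {..<n}"
begin

definition cond_mean :: "real \<Rightarrow> nat \<Rightarrow> real" where
  "cond_mean w i = (if i \<in> S then sqrt \<rho> * w else 0)"

definition residual_dev :: "nat \<Rightarrow> real" where
  "residual_dev i = (if i \<in> S then sqrt (1 - \<rho>) else 1)"

text \<open>The joint density of \<open>(w, x)\<close> factored in two ways: the density of
  \<open>w\<close> times that of \<open>x\<close> given \<open>w\<close>, and the density of
  \<open>x\<close> times the posterior density of \<open>w\<close> given \<open>x\<close>.\<close>

lemma conditional_density_eq:
  defines "D \<equiv> 1 - \<rho> + \<rho> * card S"
  shows "std_normal_density w * (\<Prod>i<n. normal_density (cond_mean w i) (residual_dev i) (x i))
    = exp (- quad_form n (mat_inv (cov_mat n \<rho> S)) x / 2)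
        / sqrt ((2 * pi) ^ n * Determinant.det (cov_mat n \<rho> S))
      * normal_density (sqrt \<rho> * (\<Sum>i\<in>S. x i) / D) (sqrt ((1 - \<rho>) / D)) w"
proof -
  define r where "r = sqrt \<rho>"
  have r: "r\<^sup>2 = \<rho>" using \<rho> by (simp add: r_def)
  have D: "0 < D" using \<rho> by (simp add: D_def add_pos_nonneg)
  have fS: "finite S" using S by (auto intro: finite_subset)
  let ?k = "card S" let ?s = "\<Sum>i\<in>S. x i" let ?W = "\<Sum>i\<in>S. (x i)\<^sup>2" let ?R = "\<Sum>i\<in>{..<n} - S. (x i)\<^sup>2"
  have "?k \<le> n" using card_mono[OF _ S] by simp
  then have pow: "a ^ n = a ^ ?k * a ^ (n - ?k)" for a :: real
    by (simp add: power_add[symmetric])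
  have "(\<Prod>i<n. normal_density (cond_mean w i) (residual_dev i) (x i))
      = (\<Prod>i<n. if i \<in> S then normal_density (r * w) (sqrt (1 - \<rho>)) (x i) else std_normal_density (x i))"
    by (intro prod.cong) (auto simp: cond_mean_def residual_dev_def r_def)
  also have "\<dots> = (1 / sqrt (2 * pi * (1 - \<rho>))) ^ ?k * exp (- (\<Sum>i\<in>S. (x i - r * w)\<^sup>2) / (2 * (1 - \<rho>)))
      * ((1 / sqrt (2 * pi)) ^ (n - ?k) * exp (- ?R / 2))"
    using \<rho> S fS by (simp add: prod_if_subset[OF finite_lessThan S] prod_normal_density card_Diff_subset)
  finally have prod: "(\<Prod>i<n. normal_density (cond_mean w i) (residual_dev i) (x i)) = \<dots>" .
  txt \<open>Complete the square in \<open>w\<close>.\<close>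
  have sq: "(\<Sum>i\<in>S. (x i - r * w)\<^sup>2) = ?W - 2 * (r * w) * ?s + ?k * (\<rho> * w\<^sup>2)"
    by (simp add: power2_diff sum.distrib sum_subtractf sum_distrib_left[symmetric]
        sum_distrib_right[symmetric] power_mult_distrib r algebra_simps)
  have "D * (w - r * ?s / D)\<^sup>2 = D * w\<^sup>2 - 2 * (r * w) * ?s + \<rho> * ?s\<^sup>2 / D"
    using D by (simp add: power2_diff power_mult_distrib power_divide r field_simps) (simp add: power2_eq_square)
  then have e1: "(1 - \<rho>) * w\<^sup>2 + (\<Sum>i\<in>S. (x i - r * w)\<^sup>2) = ?W - \<rho> * ?s\<^sup>2 / D + D * (w - r * ?s / D)\<^sup>2"
    unfolding sq by (simp add: D_def algebra_simps)
  have half: "- a / (2 * b) = - (a / b) / 2" for a b :: real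
    by simp
  have halve: "- a / 2 + (- b / 2 + - f / 2) = - (f + c - d) / 2 + - e / 2" if "a + b = c - d + e"
    for a b c d e f :: real
    using that by (simp add: field_simps)
  have "w\<^sup>2 + (\<Sum>i\<in>S. (x i - r * w)\<^sup>2) / (1 - \<rho>) = ((1 - \<rho>) * w\<^sup>2 + (\<Sum>i\<in>S. (x i - r * w)\<^sup>2)) / (1 - \<rho>)"
    using \<rho> by (simp add: field_simps)
  also have "\<dots> = ?W / (1 - \<rho>) - \<rho> * ?s\<^sup>2 / ((1 - \<rho>) * D) + (w - r * ?s / D)\<^sup>2 / ((1 - \<rho>) / D)"
    unfolding e1 add_divide_distrib diff_divide_distrib[of ?W] by (simp add: mult.commute)
  finally have ex: "- w\<^sup>2 / 2 + (- (\<Sum>i\<in>S. (x i - r * w)\<^sup>2) / (2 * (1 - \<rho>)) + - ?R / 2)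
      = - quad_form n (mat_inv (cov_mat n \<rho> S)) x / 2 + - (w - r * ?s / D)\<^sup>2 / (2 * ((1 - \<rho>) / D))"
    unfolding quad_form_mat_inv_cov_mat[OF \<rho> S] D_def[symmetric] half by (rule halve)
  have "1 + \<rho> * card S / (1 - \<rho>) = D / (1 - \<rho>)"
    using \<rho> by (simp add: D_def field_simps)
  \<comment> \<open>Determinant of the joint covariance of \<open>(w, x)\<close>, computed along
    both factorisations; this makes the normalising constants agree.\<close>
  then have det: "Determinant.det (cov_mat n \<rho> S) * ((1 - \<rho>) / D) = (1 - \<rho>) ^ ?k"
    unfolding det_cov_mat[OF \<rho> S] using \<rho> D by simp
  have "1 / sqrt ((2 * pi) ^ n * Determinant.det (cov_mat n \<rho> S)) * (1 / sqrt (2 * pi * ((1 - \<rho>) / D)))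
      = 1 / sqrt (2 * pi * ((2 * pi) ^ n * (Determinant.det (cov_mat n \<rho> S) * ((1 - \<rho>) / D))))"
    by (simp add: real_sqrt_mult[symmetric] ac_simps)
  also have "\<dots> = 1 / sqrt (2 * pi) * ((1 / sqrt (2 * pi * (1 - \<rho>))) ^ ?k * (1 / sqrt (2 * pi)) ^ (n - ?k))"
    unfolding det
    by (simp add: real_sqrt_mult real_sqrt_power power_divide power_mult_distrib pow[of "sqrt 2"] pow[of "sqrt pi"])
  finally have const: "1 / sqrt (2 * pi) * ((1 / sqrt (2 * pi * (1 - \<rho>))) ^ ?k * (1 / sqrt (2 * pi)) ^ (n - ?k))
      = 1 / sqrt ((2 * pi) ^ n * Determinant.det (cov_mat n \<rho> S)) * (1 / sqrt (2 * pi * ((1 - \<rho>) / D)))"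
    by simp
  have "std_normal_density w * (\<Prod>i<n. normal_density (cond_mean w i) (residual_dev i) (x i))
      = (1 / sqrt (2 * pi) * ((1 / sqrt (2 * pi * (1 - \<rho>))) ^ ?k * (1 / sqrt (2 * pi)) ^ (n - ?k)))
        * exp (- w\<^sup>2 / 2 + (- (\<Sum>i\<in>S. (x i - r * w)\<^sup>2) / (2 * (1 - \<rho>)) + - ?R / 2))"
    unfolding prod std_normal_density_def exp_add by (simp only: ac_simps)
  also have "\<dots> = exp (- quad_form n (mat_inv (cov_mat n \<rho> S)) x / 2)
        / sqrt ((2 * pi) ^ n * Determinant.det (cov_mat n \<rho> S))
      * normal_density (r * ?s / D) (sqrt ((1 - \<rho>) / D)) w"
    unfolding const ex exp_add normal_density_def using \<rho> D by simp
  finally show ?thesis by (simp add: r_def)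
qed

text \<open>Integrating out \<open>w\<close> leaves the density of \<open>x\<close>, because the
  posterior density of \<open>w\<close> has total mass 1.\<close>

lemma density_eq_nn_integral:
  "ennreal (exp (- quad_form n (mat_inv (cov_mat n \<rho> S)) x / 2)
        / sqrt ((2 * pi) ^ n * Determinant.det (cov_mat n \<rho> S)))
    = (\<integral>\<^sup>+w. (\<Prod>i<n. ennreal (normal_density (cond_mean w i) (residual_dev i) (x i))) \<partial>std_normal)"
    (is "ennreal ?c = _")
proof -
  define D where "D = 1 - \<rho> + \<rho> * card S"
  have D: "0 < D" using \<rho> by (simp add: D_def add_pos_nonneg)
  have det: "0 \<le> Determinant.det (cov_mat n \<rho> S)"
    unfolding det_cov_mat[OF \<rho> S] using \<rho> by simp
  have [measurable]: "(\<lambda>w. \<Prod>i<n. normal_density (cond_mean w i) (residual_dev i) (x i)) \<in> borel_measurable borel"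
    unfolding normal_density_def cond_mean_def by measurable
  have "(\<integral>\<^sup>+w. (\<Prod>i<n. ennreal (normal_density (cond_mean w i) (residual_dev i) (x i))) \<partial>std_normal)
      = (\<integral>\<^sup>+w. ennreal (std_normal_density w * (\<Prod>i<n. normal_density (cond_mean w i) (residual_dev i) (x i))) \<partial>lborel)"
    unfolding std_normal_def
    by (subst nn_integral_density) (auto simp: prod_ennreal ennreal_mult' prod_nonneg)
  also have "\<dots> = (\<integral>\<^sup>+w. ennreal ?c * ennreal (normal_density (sqrt \<rho> * (\<Sum>i\<in>S. x i) / D) (sqrt ((1 - \<rho>) / D)) w) \<partial>lborel)"
    unfolding conditional_density_eq D_def[symmetric] using det
    by (intro nn_integral_cong ennreal_mult' divide_nonneg_nonneg) auto
  also have "\<dots> = ennreal ?c * (\<integral>\<^sup>+w. ennreal (normal_density (sqrt \<rho> * (\<Sum>i\<in>S. x i) / D) (sqrt ((1 - \<rho>) / D)) w) \<partial>lborel)"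
    by (rule nn_integral_cmult) simp
  also have "(\<integral>\<^sup>+w. ennreal (normal_density (sqrt \<rho> * (\<Sum>i\<in>S. x i) / D) (sqrt ((1 - \<rho>) / D)) w) \<partial>lborel) = 1"
    using \<rho> D by (simp add: nn_integral_eq_integral)
  finally show ?thesis by simp
qed

lemma measurable_equicorrelated [measurable]:
  "equicorrelated {..<n} \<rho> S \<in> measurable (std_normal \<Otimes>\<^sub>M std_gauss {..<n}) (PiM {..<n} (\<lambda>_. lborel))"
  unfolding equicorrelated_def split_beta by measurable

text \<open>By Fubini the mixture over \<open>w\<close> can be evaluated with \<open>w\<close>
  fixed, where the coordinates are independent normal variables.\<close>

lemma law_alt_eq:
  "law_alt n \<rho> S = distr (std_normal \<Otimes>\<^sub>M std_gauss {..<n}) (PiM {..<n} (\<lambda>_. lborel)) (equicorrelated {..<n} \<rho> S)"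
    (is "_ = ?R")
proof (rule measure_eqI)
  show sets: "sets (law_alt n \<rho> S) = sets ?R"
    by (simp add: law_alt_def mvnormal_def)
  interpret P: product_sigma_finite "\<lambda>_. lborel :: real measure" by standard
  interpret P: finite_product_sigma_finite "\<lambda>_. lborel :: real measure" "{..<n}" by standard simp
  interpret Q: pair_sigma_finite std_normal "PiM {..<n} (\<lambda>_. lborel :: real measure)"
    by (intro pair_sigma_finite.intro std_normal.sigma_finite_measure_axioms P.sigma_finite_measure_axioms)
  let ?f = "\<lambda>w x. \<Prod>i<n. ennreal (normal_density (cond_mean w i) (residual_dev i) (x i))"
  have f [measurable]: "(\<lambda>(w, x). ?f w x) \<in> borel_measurable (std_normal \<Otimes>\<^sub>M PiM {..<n} (\<lambda>_. lborel))"
    unfolding normal_density_def cond_mean_def split_beta by measurable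
  fix E assume "E \<in> sets (law_alt n \<rho> S)"
  then have E [measurable]: "E \<in> sets (PiM {..<n} (\<lambda>_. lborel))"
    by (simp add: law_alt_def mvnormal_def)
  have "emeasure (law_alt n \<rho> S) E = (\<integral>\<^sup>+x. (\<integral>\<^sup>+w. ?f w x \<partial>std_normal) * indicator E x \<partial>PiM {..<n} (\<lambda>_. lborel))"
    unfolding law_alt_def mvnormal_def density_eq_nn_integral by (subst emeasure_density) auto
  also have "\<dots> = (\<integral>\<^sup>+x. (\<integral>\<^sup>+w. ?f w x * indicator E x \<partial>std_normal) \<partial>PiM {..<n} (\<lambda>_. lborel))"
    by (intro nn_integral_cong nn_integral_multc[symmetric]) auto
  also have "\<dots> = (\<integral>\<^sup>+w. (\<integral>\<^sup>+x. ?f w x * indicator E x \<partial>PiM {..<n} (\<lambda>_. lborel)) \<partial>std_normal)"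
    by (rule Q.Fubini') measurable
  also have "\<dots> = (\<integral>\<^sup>+w. emeasure (std_gauss {..<n}) (Pair w -` (equicorrelated {..<n} \<rho> S -` E
      \<inter> space (std_normal \<Otimes>\<^sub>M std_gauss {..<n}))) \<partial>std_normal)"
  \<comment> \<open>For fixed \<open>w\<close> the product density is that of an affine image of
    \<open>std_gauss\<close>, and this affine map is the section of \<open>equicorrelated\<close> at
    \<open>w\<close>.\<close>
  proof (rule nn_integral_cong)
    fix w :: real
    let ?T = "\<lambda>z. \<lambda>i\<in>{..<n}. cond_mean w i + residual_dev i * z i"
    have "(\<integral>\<^sup>+x. ?f w x * indicator E x \<partial>PiM {..<n} (\<lambda>_. lborel)) = emeasure (density (PiM {..<n} (\<lambda>_. lborel)) (?f w)) E"
      by (subst emeasure_density) auto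
    also have "\<dots> = emeasure (distr (std_gauss {..<n}) (PiM {..<n} (\<lambda>_. lborel)) ?T) E"
      using \<rho> by (subst distr_std_gauss_affine) (auto simp: residual_dev_def)
    also have "\<dots> = emeasure (std_gauss {..<n}) (?T -` E \<inter> space (std_gauss {..<n}))"
      by (intro emeasure_distr) auto
    also have "?T -` E \<inter> space (std_gauss {..<n}) = Pair w -` (equicorrelated {..<n} \<rho> S -` E
      \<inter> space (std_normal \<Otimes>\<^sub>M std_gauss {..<n}))"
    proof -
      have "?T z = equicorrelated {..<n} \<rho> S (w, z)" for z
        by (auto simp: equicorrelated_def cond_mean_def residual_dev_def fun_eq_iff)
      then show ?thesis by (auto simp: space_pair_measure)
    qed
    finally show "(\<integral>\<^sup>+x. ?f w x * indicator E x \<partial>PiM {..<n} (\<lambda>_. lborel))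
        = emeasure (std_gauss {..<n}) (Pair w -` (equicorrelated {..<n} \<rho> S -` E
          \<inter> space (std_normal \<Otimes>\<^sub>M std_gauss {..<n})))" .
  qed
  also have "\<dots> = emeasure (std_normal \<Otimes>\<^sub>M std_gauss {..<n}) (equicorrelated {..<n} \<rho> S -` E
      \<inter> space (std_normal \<Otimes>\<^sub>M std_gauss {..<n}))"
    by (rule std_gauss.emeasure_pair_measure_alt[symmetric]) measurable
  also have "\<dots> = emeasure ?R E"
    by (rule emeasure_distr[symmetric]) measurable
  finally show "emeasure (law_alt n \<rho> S) E = emeasure ?R E" .
qed

end

section \<open>The two error probabilities\<close>

text \<open>Spectral form of the statistic: \<open>U\<close> is the squared length of the component
  of \<open>x\<close> along the constant vector on \<open>S\<close>, and \<open>W - U\<close> that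
  of the orthogonal remainder within \<open>S\<close>.\<close>

lemma glr_statistic_decomposition:
  fixes x :: "nat \<Rightarrow> real"
  assumes \<rho>: "0 < \<rho>" "\<rho> < 1" and S: "S \<subseteq> {..<n}" "card S = k" "0 < k"
  shows "quad_form n (1\<^sub>m n - mat_inv (cov_mat n \<rho> S)) x
    = \<rho> * (real k - 1) / (1 - \<rho> + \<rho> * k) * ((\<Sum>i\<in>S. x i)\<^sup>2 / k)
      - \<rho> / (1 - \<rho>) * ((\<Sum>i\<in>S. (x i)\<^sup>2) - (\<Sum>i\<in>S. x i)\<^sup>2 / k)"
proof -
  define D where "D = 1 - \<rho> + \<rho> * k"
  have D: "0 < D" using \<rho> by (simp add: D_def add_pos_nonneg)
  have "real k - D = (real k - 1) * (1 - \<rho>)" by (simp add: D_def algebra_simps)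
  then have 1: "\<rho> / (1 - \<rho>) * ((real k - D) / D) = \<rho> * (real k - 1) / D"
    using \<rho> by simp
  let ?u = "(\<Sum>i\<in>S. x i)\<^sup>2" let ?W = "\<Sum>i\<in>S. (x i)\<^sup>2"
  have 2: "?u / D - ?W = (real k - D) / D * (?u / k) - (?W - ?u / k)"
    using D \<open>0 < k\<close> by (simp add: field_simps)
  have "quad_form n (1\<^sub>m n - mat_inv (cov_mat n \<rho> S)) x = \<rho> / (1 - \<rho>) * (?u / D - ?W)"
    using quad_form_glr[of \<rho> S n x] \<rho> S by (simp add: D_def)
  also have "\<dots> = \<rho> / (1 - \<rho>) * ((real k - D) / D) * (?u / k) - \<rho> / (1 - \<rho>) * (?W - ?u / k)"
    unfolding 2 by (simp only: right_diff_distrib mult.assoc)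
  finally show ?thesis
    unfolding 1 by (simp only: D_def)
qed

text \<open>The coefficient of \<open>U\<close> is at most 1, since its denominator exceeds its
  numerator by exactly 1. By Cauchy--Schwarz \<open>W - U\<close> is nonnegative, so its weight
  \<open>\<rho> / (1 - \<rho>)\<close> may be lowered to \<open>\<rho>\<close>.\<close>

lemma glr_statistic_upper:
  assumes \<rho>: "0 < \<rho>" "\<rho> < 1" and S: "S \<subseteq> {..<n}" "card S = k" "0 < k"
  shows "quad_form n (1\<^sub>m n - mat_inv (cov_mat n \<rho> S)) x
    \<le> (\<Sum>i\<in>S. x i)\<^sup>2 / k - \<rho> * ((\<Sum>i\<in>S. (x i)\<^sup>2) - (\<Sum>i\<in>S. x i)\<^sup>2 / k)"
proof -
  have D: "0 < 1 - \<rho> + \<rho> * k" using \<rho> by (simp add: add_pos_nonneg)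
  have "\<rho> * (real k - 1) / (1 - \<rho> + \<rho> * k) \<le> 1"
    using D \<rho> by (simp add: algebra_simps)
  then have "\<rho> * (real k - 1) / (1 - \<rho> + \<rho> * k) * ((\<Sum>i\<in>S. x i)\<^sup>2 / k) \<le> 1 * ((\<Sum>i\<in>S. x i)\<^sup>2 / k)"
    by (intro mult_right_mono) auto
  moreover have "0 \<le> (\<Sum>i\<in>S. (x i)\<^sup>2) - (\<Sum>i\<in>S. x i)\<^sup>2 / k"
    using sum_squared_le_sum_of_squares[of x S] S by (simp add: field_simps)
  then have "\<rho> * ((\<Sum>i\<in>S. (x i)\<^sup>2) - (\<Sum>i\<in>S. x i)\<^sup>2 / k)
      \<le> \<rho> / (1 - \<rho>) * ((\<Sum>i\<in>S. (x i)\<^sup>2) - (\<Sum>i\<in>S. x i)\<^sup>2 / k)"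
    using \<rho> by (intro mult_right_mono) (auto simp: field_simps)
  ultimately show ?thesis
    using glr_statistic_decomposition[OF \<rho> S, of x] by simp
qed

text \<open>The common shift drops out of \<open>W - U\<close>, leaving \<open>1 - \<rho>\<close>
  times the dispersion of \<open>z\<close>. This cancels the denominator \<open>1 - \<rho>\<close>,
  so the bound does not degenerate as \<open>\<rho>\<close> approaches 1.\<close>

lemma glr_statistic_equicorrelated_lower:
  fixes z :: "nat \<Rightarrow> real" and w :: real
  assumes \<rho>: "0 < \<rho>" "\<rho> < 1" and S: "S \<subseteq> {..<n}" "card S = k" "0 < k"
  defines "x \<equiv> equicorrelated {..<n} \<rho> S (w, z)"
  shows "\<rho> * (real k - 1) / (1 - \<rho> + \<rho> * k) * ((\<Sum>i\<in>S. x i)\<^sup>2 / k) - \<rho> * (\<Sum>i\<in>S. (z i)\<^sup>2)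
    \<le> quad_form n (1\<^sub>m n - mat_inv (cov_mat n \<rho> S)) x"
proof -
  define a b where "a = sqrt \<rho> * w" and "b = sqrt (1 - \<rho>)"
  have b: "b\<^sup>2 = 1 - \<rho>" using \<rho> by (simp add: b_def)
  have x: "x i = a + b * z i" if "i \<in> S" for i
    using that S by (auto simp: x_def equicorrelated_def a_def b_def)
  have s: "(\<Sum>i\<in>S. x i) = k * a + b * (\<Sum>i\<in>S. z i)"
    using S by (simp add: x sum.distrib sum_distrib_left)
  have W: "(\<Sum>i\<in>S. (x i)\<^sup>2) = k * a\<^sup>2 + 2 * a * b * (\<Sum>i\<in>S. z i) + b\<^sup>2 * (\<Sum>i\<in>S. (z i)\<^sup>2)"
  proof -
    have "(\<Sum>i\<in>S. (x i)\<^sup>2) = (\<Sum>i\<in>S. a\<^sup>2 + 2 * a * b * z i + b\<^sup>2 * (z i)\<^sup>2)"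
      by (intro sum.cong) (auto simp: x power2_sum power_mult_distrib)
    then show ?thesis
      using S by (simp add: sum.distrib sum_distrib_left)
  qed
  have "(\<Sum>i\<in>S. (x i)\<^sup>2) - (\<Sum>i\<in>S. x i)\<^sup>2 / k = b\<^sup>2 * ((\<Sum>i\<in>S. (z i)\<^sup>2) - (\<Sum>i\<in>S. z i)\<^sup>2 / k)"
    unfolding W s using \<open>0 < k\<close> by (simp add: field_simps power2_eq_square)
  also have "\<dots> \<le> (1 - \<rho>) * (\<Sum>i\<in>S. (z i)\<^sup>2)"
    unfolding b using \<rho> by (intro mult_left_mono) auto
  finally have "\<rho> / (1 - \<rho>) * ((\<Sum>i\<in>S. (x i)\<^sup>2) - (\<Sum>i\<in>S. x i)\<^sup>2 / k)
      \<le> \<rho> / (1 - \<rho>) * ((1 - \<rho>) * (\<Sum>i\<in>S. (z i)\<^sup>2))"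
    using \<rho> by (intro mult_left_mono) auto
  also have "\<dots> = \<rho> * (\<Sum>i\<in>S. (z i)\<^sup>2)" using \<rho> by simp
  finally show ?thesis
    using glr_statistic_decomposition[OF \<rho> S, of x] by simp
qed

text \<open>Union bound over the class and over two bad events for each set. The condition on
  \<open>t\<close> says that \<open>t\<close> dominates the statistic outside both events.\<close>

lemma type_I_error:
  assumes \<rho>: "0 < \<rho>" "\<rho> < 1" and \<C>: "finite \<C>" "\<C> \<noteq> {}"
    and S: "\<And>S. S \<in> \<C> \<Longrightarrow> S \<subseteq> {..<n} \<and> card S = k" and k: "0 < k"
    and L: "0 < L" and y: "0 < y" and t: "2 * L - \<rho> * k + \<rho> * (y + 2 * L) \<le> t"
  shows "measure (law_null n) {x \<in> space (law_null n). glr_test n \<rho> \<C> t x = 1}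
    \<le> card \<C> * (2 * exp (- L) / sqrt (2 * L) + exp (- y\<^sup>2 / (4 * real k)))"
proof -
  let ?G = "std_gauss {..<n}"
  define A where "A S = {z \<in> space ?G. 2 * L \<le> (\<Sum>i\<in>S. z i)\<^sup>2 / card S}" for S
  define B where "B S = {z \<in> space ?G. (\<Sum>i\<in>S. (z i)\<^sup>2) \<le> card S - y}" for S
  have meas: "A S \<in> sets ?G" "B S \<in> sets ?G" if "S \<in> \<C>" for S
  proof -
    have [measurable]: "(\<lambda>z. z i) \<in> borel_measurable ?G" if "i \<in> S" for i
      using that S[OF \<open>S \<in> \<C>\<close>] by (intro measurable_std_gauss_component) auto
    show "A S \<in> sets ?G" "B S \<in> sets ?G"
      unfolding A_def B_def by measurable
  qed
  have "{x \<in> space ?G. glr_test n \<rho> \<C> t x = 1} \<subseteq> (\<Union>S\<in>\<C>. A S \<union> B S)"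
  proof safe
    fix x assume x: "x \<in> space ?G" "glr_test n \<rho> \<C> t x = 1"
    then have "t < Max ((\<lambda>S. quad_form n (1\<^sub>m n - mat_inv (cov_mat n \<rho> S)) x) ` \<C>)"
      by (auto simp: glr_test_def split: if_splits)
    then obtain S where SC: "S \<in> \<C>" and less: "t < quad_form n (1\<^sub>m n - mat_inv (cov_mat n \<rho> S)) x"
      using \<C> by (auto simp: Max_gr_iff)
    have Sk: "S \<subseteq> {..<n}" "card S = k" using S[OF SC] by auto
    show "x \<in> (\<Union>S\<in>\<C>. A S \<union> B S)"
    proof (rule ccontr)
      assume "x \<notin> (\<Union>S\<in>\<C>. A S \<union> B S)"
      then have U: "(\<Sum>i\<in>S. x i)\<^sup>2 / k < 2 * L" and W: "k - y < (\<Sum>i\<in>S. (x i)\<^sup>2)"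
        using SC x Sk by (auto simp: A_def B_def not_le)
      \<comment> \<open>Off the bad events \<open>U\<close> is below \<open>2 * L\<close> and
        \<open>W\<close> above \<open>k - y\<close>, so the dispersion exceeds
        \<open>k - y - 2 * L\<close>.\<close>
      have "\<rho> * (k - y - 2 * L) \<le> \<rho> * ((\<Sum>i\<in>S. (x i)\<^sup>2) - (\<Sum>i\<in>S. x i)\<^sup>2 / k)"
        using U W \<rho> by (intro mult_left_mono) auto
      then have "quad_form n (1\<^sub>m n - mat_inv (cov_mat n \<rho> S)) x \<le> 2 * L - \<rho> * (k - y - 2 * L)"
        using glr_statistic_upper[OF \<rho> Sk k, of x] U by linarith
      also have "\<dots> \<le> t" using t by (simp add: algebra_simps)
      finally show False using less by simp
    qed
  qed
  then have "measure ?G {x \<in> space ?G. glr_test n \<rho> \<C> t x = 1} \<le> measure ?G (\<Union>S\<in>\<C>. A S \<union> B S)"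
    using meas \<C> by (intro std_gauss.finite_measure_mono) auto
  also have "\<dots> \<le> (\<Sum>S\<in>\<C>. measure ?G (A S \<union> B S))"
    using meas \<C> by (intro measure_UNION_le) auto
  also have "\<dots> \<le> (\<Sum>S\<in>\<C>. 2 * exp (- L) / sqrt (2 * L) + exp (- y\<^sup>2 / (4 * real k)))"
  proof (rule sum_mono)
    fix SS assume SC: "SS \<in> \<C>"
    have Sk: "SS \<subseteq> {..<n}" "card SS = k" "SS \<noteq> {}" using S[OF SC] k by auto
    have "measure ?G (A SS \<union> B SS) \<le> measure ?G (A SS) + measure ?G (B SS)"
      using meas[OF SC] by (intro measure_Un_le) auto
    also have "measure ?G (A SS) \<le> 2 * exp (- L) / sqrt (2 * L)"
      unfolding A_def using Sk L by (intro std_gauss_sum_tail) auto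
    also have "measure ?G (B SS) \<le> exp (- y\<^sup>2 / (4 * real k))"
      using chi_square_lower_tail[of "{..<n}" SS y] Sk y by (simp add: B_def)
    finally show "measure ?G (A SS \<union> B SS) \<le> 2 * exp (- L) / sqrt (2 * L) + exp (- y\<^sup>2 / (4 * real k))"
      by simp
  qed
  finally show ?thesis
    by (simp add: law_null_eq)
qed

text \<open>If the sum of the squared \<open>z i\<close> stays below \<open>k + y\<close>,
  acceptance forces \<open>\<bar>s\<bar> \<le> \<delta>\<close> by the condition on
  \<open>t\<close>. The second event is a small ball for \<open>w\<close> once \<open>z\<close> is
  fixed.\<close>

lemma type_II_error:
  assumes \<rho>: "0 < \<rho>" "\<rho> < 1" and \<C>: "finite \<C>" "S \<in> \<C>"
    and S: "S \<subseteq> {..<n}" "card S = k" and k: "2 \<le> k"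
    and y: "0 < y" "y \<le> k" and \<delta>: "0 \<le> \<delta>"
    and t: "t + \<rho> * (k + y) \<le> \<rho> * (real k - 1) / (1 - \<rho> + \<rho> * k) * (\<delta>\<^sup>2 / k)"
  shows "measure (law_alt n \<rho> S) {x \<in> space (law_alt n \<rho> S). glr_test n \<rho> \<C> t x = 0}
    \<le> exp (- y\<^sup>2 / (16 * real k)) + 2 * \<delta> / (k * sqrt \<rho>)"
proof -
  let ?G = "std_gauss {..<n}" let ?N = "std_normal" let ?T = "equicorrelated {..<n} \<rho> S"
  let ?Q = "\<lambda>x. quad_form n (1\<^sub>m n - mat_inv (cov_mat n \<rho> S)) x"
  let ?lb = "PiM {..<n} (\<lambda>_. lborel :: real measure)"
  interpret P: pair_prob_space ?N ?G ..
  have \<rho>0: "0 \<le> \<rho>" using \<rho> by simp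
  have [measurable]: "(\<lambda>z. z i) \<in> borel_measurable ?G" "(\<lambda>z. z i) \<in> borel_measurable ?lb" if "i \<in> S" for i
    using that S by (auto intro!: measurable_std_gauss_component measurable_component_singleton[of _ _ "\<lambda>_. lborel", simplified])
  have [measurable]: "?T \<in> measurable (?N \<Otimes>\<^sub>M ?G) ?lb"
    by (rule measurable_equicorrelated[OF \<rho>0 \<rho>(2) S(1)])
  have space: "space (law_alt n \<rho> S) = space ?lb" and sets: "sets (law_alt n \<rho> S) = sets ?lb"
    by (simp_all add: law_alt_def mvnormal_def)
  define E where "E = {x \<in> space ?lb. ?Q x \<le> t}"
  have E [measurable]: "E \<in> sets ?lb"
    unfolding E_def quad_form_glr[OF \<rho>0 \<rho>(2) S(1)] by measurable
  define A where "A = {z \<in> space ?G. card S + y \<le> (\<Sum>i\<in>S. (z i)\<^sup>2)}"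
  define B where "B = {p \<in> space (?N \<Otimes>\<^sub>M ?G). \<bar>k * sqrt \<rho> * fst p + sqrt (1 - \<rho>) * (\<Sum>i\<in>S. snd p i)\<bar> \<le> \<delta>}"
  have A [measurable]: "A \<in> sets ?G"
    unfolding A_def by measurable
  have B [measurable]: "B \<in> sets (?N \<Otimes>\<^sub>M ?G)"
  proof -
    have [measurable]: "(\<lambda>p. \<Sum>i\<in>S. snd p i) \<in> borel_measurable (?N \<Otimes>\<^sub>M ?G)"
      by (intro borel_measurable_sum measurable_compose[OF measurable_snd]) measurable
    show ?thesis unfolding B_def by measurable
  qed
  have D: "0 < 1 - \<rho> + \<rho> * k" using \<rho> by (simp add: add_pos_nonneg)
  interpret law: prob_space "law_alt n \<rho> S"
    unfolding law_alt_eq[OF \<rho>0 \<rho>(2) S(1)] by (rule P.prob_space_distr) measurable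
  \<comment> \<open>A small maximum makes the statistic of the true set \<open>S\<close> small as
    well.\<close>
  have "{x \<in> space (law_alt n \<rho> S). glr_test n \<rho> \<C> t x = 0} \<subseteq> E"
  proof safe
    fix x assume x: "x \<in> space (law_alt n \<rho> S)" "glr_test n \<rho> \<C> t x = 0"
    have "?Q x \<le> Max ((\<lambda>S. quad_form n (1\<^sub>m n - mat_inv (cov_mat n \<rho> S)) x) ` \<C>)"
      using \<C> by (intro Max_ge) auto
    then show "x \<in> E" using x by (auto simp: E_def space glr_test_def split: if_splits)
  qed
  then have "measure (law_alt n \<rho> S) {x \<in> space (law_alt n \<rho> S). glr_test n \<rho> \<C> t x = 0} \<le> measure (law_alt n \<rho> S) E"
    by (intro law.finite_measure_mono) (simp_all add: sets)
  also have "\<dots> = measure (?N \<Otimes>\<^sub>M ?G) (?T -` E \<inter> space (?N \<Otimes>\<^sub>M ?G))"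
    unfolding law_alt_eq[OF \<rho>0 \<rho>(2) S(1)] by (rule measure_distr) measurable
  also have "\<dots> \<le> measure (?N \<Otimes>\<^sub>M ?G) ((UNIV \<times> A) \<union> B)"
  proof (rule P.finite_measure_mono)
    show "?T -` E \<inter> space (?N \<Otimes>\<^sub>M ?G) \<subseteq> (UNIV \<times> A) \<union> B"
    proof safe
      fix w z assume E: "?T (w, z) \<in> E" and wz: "(w, z) \<in> space (?N \<Otimes>\<^sub>M ?G)" "(w, z) \<notin> B"
      show "z \<in> A"
      proof (rule ccontr)
        assume "z \<notin> A"
        then have less: "(\<Sum>i\<in>S. (z i)\<^sup>2) < k + y" using wz S by (auto simp: A_def space_pair_measure)
        let ?s = "\<Sum>i\<in>S. ?T (w, z) i"
        have "?s = (\<Sum>i\<in>S. sqrt \<rho> * w + sqrt (1 - \<rho>) * z i)"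
          using S by (intro sum.cong) (auto simp: equicorrelated_def)
        also have "\<dots> = k * sqrt \<rho> * w + sqrt (1 - \<rho>) * (\<Sum>i\<in>S. z i)"
          using S by (simp add: sum.distrib sum_distrib_left)
        finally have s: "?s = \<dots>" .
        have "\<rho> * (\<Sum>i\<in>S. (z i)\<^sup>2) \<le> \<rho> * (k + y)" using less \<rho> by (intro mult_left_mono) auto
        moreover have "?Q (?T (w, z)) \<le> t" using E by (simp add: E_def)
        moreover note glr_statistic_equicorrelated_lower[OF \<rho> S, of w z]
        ultimately have "\<rho> * (real k - 1) / (1 - \<rho> + \<rho> * k) * (?s\<^sup>2 / k)
            \<le> \<rho> * (real k - 1) / (1 - \<rho> + \<rho> * k) * (\<delta>\<^sup>2 / k)"
          using t k by linarith
        \<comment> \<open>Strict positivity, which rests on \<open>2 \<le> k\<close>, allows this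
          coefficient to be cancelled.\<close>
        moreover have "0 < \<rho> * (real k - 1) / (1 - \<rho> + \<rho> * k)"
          using \<rho> k D by simp
        ultimately have "?s\<^sup>2 \<le> \<delta>\<^sup>2"
          using k by (subst (asm) mult_le_cancel_left_pos) (auto simp: divide_le_cancel)
        then have "\<bar>?s\<bar> \<le> \<delta>" using \<delta> by (simp add: abs_le_square_iff[symmetric])
        then show False using wz by (simp add: B_def s)
      qed
    qed auto
  qed measurable
  also have "\<dots> \<le> measure (?N \<Otimes>\<^sub>M ?G) (UNIV \<times> A) + measure (?N \<Otimes>\<^sub>M ?G) B"
    by (rule measure_Un_le) measurable
  also have "measure (?N \<Otimes>\<^sub>M ?G) (UNIV \<times> A) = measure ?G A"
    using std_gauss.emeasure_pair_measure_Times[of UNIV ?N A] std_normal.emeasure_space_1 A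
    by (simp add: measure_def)
  also have "measure ?G A \<le> exp (- y\<^sup>2 / (16 * real k))"
    using chi_square_upper_tail[of "{..<n}" S y] S y by (simp add: A_def)
  also have "measure (?N \<Otimes>\<^sub>M ?G) B \<le> 2 * \<delta> / (k * sqrt \<rho>)"
  proof -
    have "emeasure (?N \<Otimes>\<^sub>M ?G) B = (\<integral>\<^sup>+z. emeasure ?N ((\<lambda>w. (w, z)) -` B) \<partial>?G)"
      by (rule P.emeasure_pair_measure_alt2) measurable
    \<comment> \<open>With \<open>z\<close> fixed, the sum is affine in \<open>w\<close> with slope
      \<open>k * sqrt \<rho>\<close>, and the small-ball bound does not depend on the
      offset.\<close>
    also have "\<dots> \<le> (\<integral>\<^sup>+z. ennreal (2 * \<delta> / (k * sqrt \<rho>)) \<partial>?G)"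
    proof (rule nn_integral_mono)
      fix z assume "z \<in> space ?G"
      then have "(\<lambda>w. (w, z)) -` B = {w. \<bar>(k * sqrt \<rho>) * w + sqrt (1 - \<rho>) * (\<Sum>i\<in>S. z i)\<bar> \<le> \<delta>}"
        by (auto simp: B_def space_pair_measure)
      then show "emeasure ?N ((\<lambda>w. (w, z)) -` B) \<le> ennreal (2 * \<delta> / (k * sqrt \<rho>))"
        using std_normal_small_ball[of "k * sqrt \<rho>" \<delta>] \<delta> \<rho> k
        by (simp add: std_normal.emeasure_eq_measure ennreal_leI)
    qed
    also have "\<dots> = ennreal (2 * \<delta> / (k * sqrt \<rho>))"
      by (simp add: std_gauss.emeasure_space_1)
    finally show ?thesis
      using \<delta> \<rho> by (simp add: P.emeasure_eq_measure)
  qed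
  finally show ?thesis by simp
qed

section \<open>Calibration of the threshold and of the error bounds\<close>

lemma sqrt_gap:
  fixes k L :: real
  assumes "0 \<le> L" "10000 * L \<le> k"
  shows "sqrt (24 / 5 * k * L) + 2 * L \<le> sqrt (5 * k * L)"
proof -
  have k: "0 \<le> k" using assms by linarith
  \<comment> \<open>The factor 10000 is the square of 100: the term \<open>2 * L\<close> costs at
    most \<open>2 / 100\<close> in the coefficient of \<open>sqrt (k * L)\<close>.\<close>
  have s: "L \<le> sqrt (k * L) / 100"
  proof -
    have "(100 * L)\<^sup>2 \<le> k * L"
      using mult_right_mono[OF assms(2,1)] by (simp add: power2_eq_square algebra_simps)
    then show ?thesis using real_le_rsqrt by fastforce
  qed
  \<comment> \<open>The rational bounds leave enough room, since 2.2 + 0.02 is below 2.23.\<close>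
  have "sqrt (24 / 5) \<le> 22 / 10"
    by (rule real_le_lsqrt) (auto simp: power2_eq_square)
  moreover have "223 / 100 \<le> sqrt (5 :: real)"
    by (rule real_le_rsqrt) (auto simp: power2_eq_square)
  ultimately have "(sqrt (24 / 5) + 2 / 100) * sqrt (k * L) \<le> sqrt 5 * sqrt (k * L)"
    using k assms by (intro mult_right_mono) auto
  then have "sqrt (24 / 5) * sqrt (k * L) + 2 * L \<le> sqrt 5 * sqrt (k * L)"
    using s by (simp add: distrib_right)
  then show ?thesis by (simp add: real_sqrt_mult[symmetric] mult.assoc)
qed

text \<open>The left side is \<open>t + \<rho> * (k + y)\<close> for the threshold of the theorem.
  The radius \<open>k * sqrt \<rho> * sqrt \<eta>\<close> is chosen so that the small-ball
  probability is at most \<open>2 * sqrt \<eta>\<close>, and \<open>\<eta>\<close> tends to 0 with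
  \<open>L / k\<close> and \<open>L / (\<rho> * k)\<close>.\<close>

lemma small_ball_radius:
  fixes \<rho> k L :: real
  assumes \<rho>: "0 < \<rho>" "\<rho> < 1" and k: "2 \<le> k" and L: "1 \<le> L"
  defines "\<eta> \<equiv> 4 * (sqrt (5 * (L / k)) + L / (\<rho> * k)) * (1 + L / (\<rho> * k))"
  defines "y \<equiv> sqrt (5 * k * L)"
  shows "2 * \<rho> * y + 2 * L \<le> \<rho> * (k - 1) / (1 - \<rho> + \<rho> * k) * ((k * sqrt \<rho> * sqrt \<eta>)\<^sup>2 / k)"
proof -
  have pos: "0 < \<rho> * k" using \<rho> k by simp
  have D: "0 < 1 - \<rho> + \<rho> * k" using pos \<rho> by linarith
  have \<eta>: "0 \<le> \<eta>" using \<rho> k L by (simp add: \<eta>_def)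
  have y: "y / k = sqrt (5 * (L / k))"
  proof -
    have "y / k = sqrt (5 * k * L / k\<^sup>2)" using k by (simp add: y_def real_sqrt_divide)
    also have "5 * k * L / k\<^sup>2 = 5 * (L / k)" using k by (simp add: power2_eq_square)
    finally show ?thesis .
  qed
  \<comment> \<open>The right side is \<open>\<rho> * k + L\<close>, and
    \<open>1 - \<rho> \<le> L\<close>.\<close>
  have "1 - \<rho> + \<rho> * k \<le> \<rho> * k * (1 + L / (\<rho> * k))"
    using \<rho> L k pos by (auto simp: distrib_left)
  moreover have "2 * \<rho> * y + 2 * L = 2 * (\<rho> * k) * (y / k + L / (\<rho> * k))"
    using \<rho> k by (simp add: field_simps)
  moreover have "0 \<le> 2 * (\<rho> * k) * (y / k + L / (\<rho> * k))"
    using \<rho> k L by (simp add: y_def)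
  ultimately have "(2 * \<rho> * y + 2 * L) * (1 - \<rho> + \<rho> * k)
      \<le> 2 * (\<rho> * k) * (y / k + L / (\<rho> * k)) * (\<rho> * k * (1 + L / (\<rho> * k)))"
    by (metis mult_left_mono)
  also have "\<dots> = (\<rho> * k)\<^sup>2 * \<eta> / 2"
    unfolding y \<eta>_def by (simp add: power2_eq_square)
  also have "\<dots> = \<rho> * (k / 2) * (k * \<rho> * \<eta>)"
    by (simp add: power2_eq_square)
  \<comment> \<open>Here \<open>2 \<le> k\<close> gives \<open>k / 2 \<le> k - 1\<close>; this
    halving and the factor 2 on the left account for the 4 in \<open>\<eta>\<close>.\<close>
  also have "\<dots> \<le> \<rho> * (k - 1) * (k * \<rho> * \<eta>)"
    using \<rho> k \<eta> by (intro mult_right_mono mult_left_mono) auto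
  also have "k * \<rho> * \<eta> = (k * sqrt \<rho> * sqrt \<eta>)\<^sup>2 / k"
    using \<rho> k \<eta> by (simp add: power_mult_distrib) (simp add: power2_eq_square)
  finally show ?thesis
    using D by (simp only: times_divide_eq_left pos_le_divide_eq)
qed

text \<open>To be used with \<open>a = L / k\<close> and \<open>b = L / (\<rho> * k)\<close>. The
  first two summands bound the error under the null hypothesis, the bracket the error under any
  alternative.\<close>

definition risk_bound :: "real \<Rightarrow> real \<Rightarrow> real \<Rightarrow> real" where
  "risk_bound L a b = 2 / sqrt (2 * L) + exp (- L / 5)
    + (exp (- 5 * L / 16) + 2 * sqrt (4 * (sqrt (5 * a) + b) * (1 + b)))"

lemma tendsto_risk_bound:
  assumes "filterlim L at_top F" "(a \<longlongrightarrow> 0) F" "(b \<longlongrightarrow> 0) F"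
  shows "((\<lambda>n. risk_bound (L n) (a n) (b n)) \<longlongrightarrow> 0) F"
proof -
  have 1: "((\<lambda>x::real. 2 / sqrt (2 * x) + exp (- x / 5) + exp (- 5 * x / 16)) \<longlongrightarrow> 0) at_top"
    by real_asymp
  have "((\<lambda>n. 2 / sqrt (2 * L n) + exp (- L n / 5) + exp (- 5 * L n / 16)
      + 2 * sqrt (4 * (sqrt (5 * a n) + b n) * (1 + b n))) \<longlongrightarrow> 0 + 2 * sqrt (4 * (sqrt (5 * 0) + 0) * (1 + 0))) F"
    by (intro tendsto_intros filterlim_compose[OF 1] assms)
  then show ?thesis
    by (simp add: risk_bound_def add.assoc)
qed

theorem proposition3p2:
  fixes k N :: "nat \<Rightarrow> nat" and \<rho> t :: "nat \<Rightarrow> real" and \<C> :: "nat \<Rightarrow> nat set set"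
  assumes k: "\<And>n. n \<ge> 2 \<Longrightarrow> 2 \<le> k n \<and> k n \<le> n"
    and \<rho>: "\<And>n. n \<ge> 2 \<Longrightarrow> \<rho> n \<in> {0<..<1}"
    and \<C>: "\<And>n S. n \<ge> 2 \<Longrightarrow> S \<in> \<C> n \<Longrightarrow> S \<subseteq> {..<n} \<and> card S = k n"
    and N: "\<And>n. N n = card (\<C> n)"
    and N_lim: "filterlim N at_top sequentially"
    and log_N_lim: "(\<lambda>n. ln (real (N n)) / real (k n)) \<longlonglongrightarrow> 0"
    and \<rho>_lim: "filterlim (\<lambda>n. \<rho> n * real (k n) / ln (real (N n))) at_top sequentially"
    and t: "\<And>n. t n = - \<rho> n * real (k n) + \<rho> n * sqrt (5 * real (k n) * ln (real (N n)))
                        + 2 * ln (real (N n))"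
  shows "(\<lambda>n. max_risk n (\<rho> n) (\<C> n) (glr_test n (\<rho> n) (\<C> n) (t n))) \<longlonglongrightarrow> 0"
proof (rule tendsto_sandwich[where f = "\<lambda>_. 0"])
  define L where "L n = ln (real (N n))" for n
  let ?b = "\<lambda>n. L n / (\<rho> n * real (k n))"
  let ?risk = "\<lambda>n. max_risk n (\<rho> n) (\<C> n) (glr_test n (\<rho> n) (\<C> n) (t n))"
  let ?bound = "\<lambda>n. risk_bound (L n) (L n / real (k n)) (?b n)"
  have L_lim: "filterlim L at_top sequentially"
    unfolding L_def
    by (intro filterlim_compose[OF ln_at_top] filterlim_compose[OF filterlim_real_sequentially] N_lim)
  have "(\<lambda>n. inverse (\<rho> n * real (k n) / L n)) \<longlonglongrightarrow> 0"
    using \<rho>_lim unfolding L_def by (rule tendsto_inverse_0_at_top)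
  then have b_lim: "?b \<longlonglongrightarrow> 0" by simp
  show "?bound \<longlonglongrightarrow> 0"
    using log_N_lim by (intro tendsto_risk_bound L_lim b_lim) (simp add: L_def)
  \<comment> \<open>The numerical threshold is the one required by \<open>sqrt_gap\<close>.\<close>
  have "\<forall>\<^sub>F n in sequentially. L n / real (k n) < 1 / 10000"
    using log_N_lim unfolding L_def by (rule order_tendstoD) simp
  moreover have "\<forall>\<^sub>F n in sequentially. 1 \<le> L n"
    using L_lim by (simp add: filterlim_at_top)
  moreover have "\<forall>\<^sub>F n in sequentially. n \<ge> (2 :: nat)"
    by (rule eventually_ge_at_top)
  ultimately have ev: "\<forall>\<^sub>F n in sequentially. 0 \<le> ?risk n \<and> ?risk n \<le> ?bound n"
  proof eventually_elim
    case (elim n)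
    have k2: "2 \<le> k n" and kpos: "0 < real (k n)" and \<rho>n: "0 < \<rho> n" "\<rho> n < 1"
      using k[OF elim(3)] \<rho>[OF elim(3)] by auto
    have L1: "1 \<le> L n" by (rule elim(2))
    have Lk: "10000 * L n \<le> real (k n)"
      using elim(1) kpos by (simp add: field_simps)
    \<comment> \<open>In HOL \<open>ln 0 = 0\<close>, so \<open>1 \<le> L n\<close> excludes a zero
      cardinality, which is also the value of \<open>card\<close> on infinite sets.\<close>
    have "N n \<noteq> 0" using L1 by (auto simp: L_def intro!: Nat.gr0I)
    then have fin: "finite (\<C> n)" "\<C> n \<noteq> {}" using N[of n] by (auto intro: card_ge_0_finite)
    have NL: "real (card (\<C> n)) = exp (L n)" using \<open>N n \<noteq> 0\<close> N[of n] by (simp add: L_def)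
    have S: "\<And>S. S \<in> \<C> n \<Longrightarrow> S \<subseteq> {..<n} \<and> card S = k n" using \<C>[OF elim(3)] by auto
    \<comment> \<open>\<open>y'\<close> is the deviation built into \<open>t\<close>; the slightly
      smaller \<open>y\<close> serves under the null hypothesis and leaves room for
      \<open>2 * L n\<close>.\<close>
    define y y' where "y = sqrt (24 / 5 * real (k n) * L n)" and "y' = sqrt (5 * real (k n) * L n)"
    have tn: "t n = 2 * L n - \<rho> n * k n + \<rho> n * y'"
      unfolding t by (simp add: L_def y'_def)
    have y: "0 < y" "y\<^sup>2 / (4 * real (k n)) = 6 / 5 * L n" using kpos L1 by (auto simp: y_def)
    have y': "0 < y'" "y'\<^sup>2 / (16 * real (k n)) = 5 * L n / 16" using kpos L1 by (auto simp: y'_def)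
    \<comment> \<open>Needed for the upper chi-square tail.\<close>
    have "y' \<le> k n"
      unfolding y'_def using kpos Lk L1
      by (intro real_le_lsqrt) (auto simp: power2_eq_square)
    have "y + 2 * L n \<le> y'"
      unfolding y_def y'_def using L1 Lk by (intro sqrt_gap) auto
    then have "\<rho> n * (y + 2 * L n) \<le> \<rho> n * y'" using \<rho>n by (intro mult_left_mono) auto
    then have "measure (law_null n) {x \<in> space (law_null n). glr_test n (\<rho> n) (\<C> n) (t n) x = 1}
        \<le> card (\<C> n) * (2 * exp (- L n) / sqrt (2 * L n) + exp (- y\<^sup>2 / (4 * real (k n))))"
      using k2 L1 y(1) by (intro type_I_error[OF \<rho>n fin]) (auto simp: tn dest: S)
    \<comment> \<open>The cardinality \<open>exp (L n)\<close> cancels \<open>exp (- L n)\<close>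
      exactly, and it reduces \<open>exp (- 6 / 5 * L n)\<close> to
      \<open>exp (- L n / 5)\<close>.\<close>
    also have "\<dots> = 2 / sqrt (2 * L n) + exp (- L n / 5)"
      unfolding NL minus_divide_left[symmetric] y(2)
      by (simp add: distrib_left mult_exp_exp)
    finally have I: "measure (law_null n) {x \<in> space (law_null n). glr_test n (\<rho> n) (\<C> n) (t n) x = 1} \<le> \<dots>" .
    define \<eta> where "\<eta> = 4 * (sqrt (5 * (L n / k n)) + ?b n) * (1 + ?b n)"
    have \<eta>: "0 \<le> \<eta>" using \<rho>n kpos L1 by (simp add: \<eta>_def)
    have II: "measure (law_alt n (\<rho> n) S) {x \<in> space (law_alt n (\<rho> n) S). glr_test n (\<rho> n) (\<C> n) (t n) x = 0}
        \<le> exp (- 5 * L n / 16) + 2 * sqrt \<eta>" if "S \<in> \<C> n" for S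
    proof -
      \<comment> \<open>The centring term \<open>- \<rho> n * k n\<close> of the threshold offsets
        the mean of the chi-square variable.\<close>
      have "t n + \<rho> n * (k n + y') = 2 * \<rho> n * y' + 2 * L n"
        unfolding tn by (simp add: algebra_simps)
      also have "\<dots> \<le> \<rho> n * (real (k n) - 1) / (1 - \<rho> n + \<rho> n * k n)
          * ((k n * sqrt (\<rho> n) * sqrt \<eta>)\<^sup>2 / k n)"
        unfolding \<eta>_def y'_def using \<rho>n k2 L1 by (intro small_ball_radius) auto
      finally have "measure (law_alt n (\<rho> n) S) {x \<in> space (law_alt n (\<rho> n) S). glr_test n (\<rho> n) (\<C> n) (t n) x = 0}
          \<le> exp (- y'\<^sup>2 / (16 * real (k n))) + 2 * (k n * sqrt (\<rho> n) * sqrt \<eta>) / (k n * sqrt (\<rho> n))"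
        using S[OF that] \<rho>n \<eta> y'(1) \<open>y' \<le> k n\<close> k2
        by (intro type_II_error[OF \<rho>n fin(1) that]) auto
      then show ?thesis
        unfolding minus_divide_left[symmetric] y'(2) using \<rho>n kpos by simp
    qed
    let ?II = "(\<lambda>S. measure (law_alt n (\<rho> n) S) {x \<in> space (law_alt n (\<rho> n) S). glr_test n (\<rho> n) (\<C> n) (t n) x = 0}) ` \<C> n"
    have "Max ?II \<le> exp (- 5 * L n / 16) + 2 * sqrt \<eta>"
      using fin II by (subst Max_le_iff) auto
    then have "?risk n \<le> ?bound n"
      using I unfolding max_risk_def risk_bound_def \<eta>_def by linarith
    moreover have "0 \<le> Max ?II"
      using fin by (subst Max_ge_iff) auto
    then have "0 \<le> ?risk n"
      unfolding max_risk_def by (intro add_nonneg_nonneg measure_nonneg)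
    ultimately show ?case by simp
  qed
  then show "\<forall>\<^sub>F n in sequentially. 0 \<le> ?risk n" "\<forall>\<^sub>F n in sequentially. ?risk n \<le> ?bound n"
    by (auto elim: eventually_mono)
qed simp

end
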